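(* Let $\mathcal{R}$ be an LCTRS. For any reachability formula $\varphi\Rightarrow\varphi'$, we have $\mathcal{R}\models^{\forall}\varphi\Rightarrow\varphi'$ if and only if $\varphi\Rightarrow\varphi'\in\nu\,\widehat{\mathsf{DSTEP}}(\mathcal{R})$.
   Context: Setting. Fix a many-sorted builtin signature $\Sigma^b=(S^b,F^b)$ with sort $\mathit{Bool}$, and a builtin model $M^b$ with $M^b_{\mathit{Bool}}=\{\top,\bot\}$. A signature modulo builtins is a preregular order-sorted signature $\Sigma=(S,\le,F)$ containing $\Sigma^b$ whose constants of each builtin sort $s$ are exactly the elements of $M^b_s$. $\Sigma^c$ (constructors) consists of $F\setminus F^b$ plus builtin constants. $M^\Sigma$ is the $\Sigma$-model with builtin carriers/functions as in $M^b$, $M^\Sigma_s$ = ground $\Sigma^c$-terms of sort $s$ for non-builtin $s$, and non-builtin symbols interpreted as term constructors; carriers are nonempty. Constraint formulas are first-order formulas with equality over $\Sigma$ interpreted in $M^\Sigma$. A constrained term is $t\mid\phi$ ($t$ a term with variables, $\phi$ a constraint formula); $\llbracket t\mid\phi\rrbracket=\{\alpha(t)\mid M^\Sigma,\alpha\models\phi\}$; $\mathit{var}(t\mid\phi)$ is the set of variables of $t$ and free variables of $\phi$. An LCTRS $\mathcal{R}$ is a set of rules $l\to r\text{ if }\phi$ ($l,r$ of the same sort); $u\to_{\mathcal{R}}u'$ on $M^\Sigma$ iff $u=\alpha(c[l])$, $u'=\alpha(c[r])$, $M^\Sigma,\alpha\models\phi$ for some rule, context $c[\cdot]$ (term with one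 hole) and valuation $\alpha$. Abstract reachability. For a transition system $(M,\to)$ and $P\subseteq M$: $\partial(P)=\{\gamma'\mid\exists\gamma\in P,\gamma\to\gamma'\}$; $P$ is runnable if $P\neq\emptyset$ and each element of $P$ has a successor. $(M,\to)\models^\forall P\Rightarrow Q$ iff $P\Rightarrow Q$ lies in the greatest fixed point of the rules: (Subsumption) $P\Rightarrow Q$ with no premises if $P\subseteq Q$; (Step) from $\partial(P\setminus Q)\Rightarrow Q$ infer $P\Rightarrow Q$ if $P\setminus Q$ is runnable. A reachability formula is a pair $\varphi\Rightarrow\varphi'$ of constrained terms (possibly sharing variables); $\mathcal{R}\models^\forall\varphi\Rightarrow\varphi'$ iff $(M^\Sigma,\to_{\mathcal{R}})\models^\forall\llbracket\sigma(\varphi)\rrbracket\Rightarrow\llbracket\sigma(\varphi')\rrbracket$ for every $\sigma:\mathit{var}(\varphi)\cap\mathit{var}(\varphi')\to M^\Sigma$. Two reachability formulas are equivalent ($\equiv$) if for every LCTRS $\mathcal{R}$ one is satisfied by $\mathcal{R}$ iff the other is. Derivatives: $\Delta_{\mathcal{R}}(t\mid\phi)$ is the set of all $c[r]\mid(\phi\wedge t=c[l]\wedge\phi_{lr})$, over rules $l\to r\text{ if }\phi_{lr}$ of $\mathcal{R}$ (renamed apart from $t\mid\phi$) and contexts $c[\cdot]$, for which the constraint is satisfiable; $t\mid\phi$ is $\mathcal{R}$-derivable if $\Delta_{\mathcal{R}}(t\mid\phi)\neq\emptyset$. The proof system $\mathsf{DSTEP}(\mathcal{R})$ has the rules: [axiom]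 $t_l\mid\bot\Rightarrow t_r\mid\phi_r$ with no premises; [subs] from $t_l\mid\phi_l\wedge\neg(\exists\tilde x.\,t_l=t_r\wedge\phi_r)\Rightarrow t_r\mid\phi_r$ infer $t_l\mid\phi_l\Rightarrow t_r\mid\phi_r$, where $\tilde x=\mathit{var}(t_r,\phi_r)\setminus\mathit{var}(t_l,\phi_l)$ and $\exists\tilde x.\,t_l=t_r\wedge\phi_r$ is satisfiable; [der$^\forall$] if $t_l\mid\phi_l$ is $\mathcal{R}$-derivable, $\Delta_{\mathcal{R}}(t_l\mid\phi_l)=\{t^1\mid\phi^1,\dots,t^n\mid\phi^n\}$ and $\phi_l\to\bigvee_{j}\exists\tilde y^j.\phi^j$ is valid in $M^\Sigma$ (with $\tilde y^j=\mathit{var}(t^j,\phi^j)\setminus\mathit{var}(t_l,\phi_l)$), then from $t^j\mid\phi^j\Rightarrow t_r\mid\phi_r$ for all $j=1,\dots,n$ infer $t_l\mid\phi_l\Rightarrow t_r\mid\phi_r$; plus an implicit structural rule allowing any reachability formula to be replaced by an equivalent one. $\nu\,\widehat{\mathsf{DSTEP}}(\mathcal{R})$ is the greatest fixed point of the one-step closure operator of this rule system (i.e. the formulas having a possibly infinite proof tree).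
   Formalization: With the plain greatest fixed point soundness fails (endless [subs] or structural steps), so infinite branches must use [der] infinitely often and the structural rule finitely often; [der] may have infinitely many premises, and fresh variables also avoid the right-hand side. *)

theory Defs
  imports Main
begin

section \<open>Signatures modulo builtins\<close>

text \<open>
  The carrier of a builtin sort consists of function symbols, because the elements of the builtin
  model are themselves the constants of the builtin sorts. The set of sorts is the type \<open>'s\<close>.
\<close>

record ('s, 'f) builtins =
  bsorts :: "'s set"
  branks :: "'f \<Rightarrow> ('s list \<times> 's) set"
  bool_sort :: 's
  bcarrier :: "'s \<Rightarrow> 'f set"
  binterp :: "'f \<Rightarrow> 'f list \<Rightarrow> 'f"
  btrue :: 'f
  bfalse :: 'f

record ('s, 'f) signature = "('s, 'f) builtins" +
  subsort :: "'s \<Rightarrow> 's \<Rightarrow> bool"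
  ranks :: "'f \<Rightarrow> ('s list \<times> 's) set"

definition builtin_model :: "('s, 'f, 'z) builtins_scheme \<Rightarrow> bool" where
  "builtin_model B \<longleftrightarrow>
     bool_sort B \<in> bsorts B \<and>
     bcarrier B (bool_sort B) = {btrue B, bfalse B} \<and> btrue B \<noteq> bfalse B \<and>
     (\<forall>f ws s. (ws, s) \<in> branks B f \<longrightarrow> set ws \<subseteq> bsorts B \<and> s \<in> bsorts B) \<and>
     (\<forall>f ws s bs. (ws, s) \<in> branks B f \<longrightarrow> list_all2 (\<lambda>b w. b \<in> bcarrier B w) bs ws
        \<longrightarrow> binterp B f bs \<in> bcarrier B s)"

definition preregular :: "('s, 'f) signature \<Rightarrow> bool" where
  "preregular \<Sigma> \<longleftrightarrow>
     (\<forall>f us. let T = {s. \<exists>ws. (ws, s) \<in> ranks \<Sigma> f \<and> list_all2 (subsort \<Sigma>) us ws}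
             in T \<noteq> {} \<longrightarrow> (\<exists>s\<in>T. \<forall>s'\<in>T. subsort \<Sigma> s s'))"

definition order_sorted :: "('s, 'f) signature \<Rightarrow> bool" where
  "order_sorted \<Sigma> \<longleftrightarrow>
     (\<forall>s. subsort \<Sigma> s s) \<and>
     (\<forall>s s'. subsort \<Sigma> s s' \<longrightarrow> subsort \<Sigma> s' s \<longrightarrow> s = s') \<and>
     (\<forall>s s' s''. subsort \<Sigma> s s' \<longrightarrow> subsort \<Sigma> s' s'' \<longrightarrow> subsort \<Sigma> s s'')"

text \<open>
  Being builtin is a property of a symbol, not of a rank: a builtin operation has no further ranks
  in the larger signature. A builtin constant denotes itself.
\<close>

definition signature_mod_builtins :: "('s, 'f) signature \<Rightarrow> bool" where
  "signature_mod_builtins \<Sigma> \<longleftrightarrow>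
     builtin_model \<Sigma> \<and> order_sorted \<Sigma> \<and> preregular \<Sigma> \<and>
     (\<forall>f. branks \<Sigma> f \<subseteq> ranks \<Sigma> f) \<and>
     (\<forall>f ws s. branks \<Sigma> f \<noteq> {} \<longrightarrow> ws \<noteq> [] \<longrightarrow> (ws, s) \<in> ranks \<Sigma> f \<longrightarrow> (ws, s) \<in> branks \<Sigma> f) \<and>
     (\<forall>s\<in>bsorts \<Sigma>. {c. ([], s) \<in> ranks \<Sigma> c} = bcarrier \<Sigma> s) \<and>
     (\<forall>c s. ([], s) \<in> branks \<Sigma> c \<longrightarrow> binterp \<Sigma> c [] = c)"


section \<open>Terms and contexts\<close>

text \<open>A variable is a name together with its sort.\<close>

type_synonym 's var = "nat \<times> 's"

datatype ('s, 'f) trm = Var "'s var" | Fun 'f "('s, 'f) trm list"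

datatype ('s, 'f) ctxt = Hole | More 'f "('s, 'f) trm list" "('s, 'f) ctxt" "('s, 'f) trm list"

primrec vars :: "('s, 'f) trm \<Rightarrow> 's var set" where
  "vars (Var x) = {x}"
| "vars (Fun f ts) = \<Union> (set (map vars ts))"

primrec subst :: "('s var \<Rightarrow> ('s, 'f) trm) \<Rightarrow> ('s, 'f) trm \<Rightarrow> ('s, 'f) trm" where
  "subst \<sigma> (Var x) = \<sigma> x"
| "subst \<sigma> (Fun f ts) = Fun f (map (subst \<sigma>) ts)"

primrec plug :: "('s, 'f) ctxt \<Rightarrow> ('s, 'f) trm \<Rightarrow> ('s, 'f) trm" where
  "plug Hole t = t"
| "plug (More f ts c us) t = Fun f (ts @ plug c t # us)"

primrec vars_ctxt :: "('s, 'f) ctxt \<Rightarrow> 's var set" where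
  "vars_ctxt Hole = {}"
| "vars_ctxt (More f ts c us) = \<Union> (vars ` set ts) \<union> vars_ctxt c \<union> \<Union> (vars ` set us)"

inductive sort_wrt ::
  "('s \<Rightarrow> 's \<Rightarrow> bool) \<Rightarrow> ('f \<Rightarrow> ('s list \<times> 's) set) \<Rightarrow> ('s, 'f) trm \<Rightarrow> 's \<Rightarrow> bool"
  for le rk where
  "le (snd x) s \<Longrightarrow> sort_wrt le rk (Var x) s"
| "(ws, s') \<in> rk f \<Longrightarrow> list_all2 (sort_wrt le rk) ts ws \<Longrightarrow> le s' s
     \<Longrightarrow> sort_wrt le rk (Fun f ts) s"

definition has_sort :: "('s, 'f) signature \<Rightarrow> ('s, 'f) trm \<Rightarrow> 's \<Rightarrow> bool" where
  "has_sort \<Sigma> = sort_wrt (subsort \<Sigma>) (ranks \<Sigma>)"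

definition wf_trm :: "('s, 'f) signature \<Rightarrow> ('s, 'f) trm \<Rightarrow> bool" where
  "wf_trm \<Sigma> t \<longleftrightarrow> (\<exists>s. has_sort \<Sigma> t s)"

text \<open>\<open>ctxt_sort \<Sigma> h c s\<close>: \<open>c\<close> is a context of sort \<open>s\<close> whose hole has sort \<open>h\<close>.\<close>

inductive ctxt_sort :: "('s, 'f) signature \<Rightarrow> 's \<Rightarrow> ('s, 'f) ctxt \<Rightarrow> 's \<Rightarrow> bool"
  for \<Sigma> h where
  "subsort \<Sigma> h s \<Longrightarrow> ctxt_sort \<Sigma> h Hole s"
| "(ws @ w # vs, s') \<in> ranks \<Sigma> f \<Longrightarrow> list_all2 (has_sort \<Sigma>) ts ws \<Longrightarrow> ctxt_sort \<Sigma> h c w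
     \<Longrightarrow> list_all2 (has_sort \<Sigma>) us vs \<Longrightarrow> subsort \<Sigma> s' s \<Longrightarrow> ctxt_sort \<Sigma> h (More f ts c us) s"


section \<open>The model\<close>

definition constructor_ranks :: "('s, 'f) signature \<Rightarrow> 'f \<Rightarrow> ('s list \<times> 's) set" where
  "constructor_ranks \<Sigma> f =
     {(ws, s). (ws, s) \<in> ranks \<Sigma> f \<and> (branks \<Sigma> f = {} \<or> ws = [] \<and> s \<in> bsorts \<Sigma>)}"

text \<open>
  An element \<open>b\<close> of a builtin carrier is represented by the constant \<open>Fun b []\<close>, so that all model
  elements are ground terms.
\<close>

definition carrier :: "('s, 'f) signature \<Rightarrow> 's \<Rightarrow> ('s, 'f) trm set" where
  "carrier \<Sigma> s =
     (if s \<in> bsorts \<Sigma> then {Fun b [] | b. b \<in> bcarrier \<Sigma> s}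
      else {t. vars t = {} \<and> sort_wrt (subsort \<Sigma>) (constructor_ranks \<Sigma>) t s})"

primrec root :: "('s, 'f) trm \<Rightarrow> 'f" where
  "root (Fun f ts) = f"

definition interp :: "('s, 'f) signature \<Rightarrow> 'f \<Rightarrow> ('s, 'f) trm list \<Rightarrow> ('s, 'f) trm" where
  "interp \<Sigma> f vs =
     (if branks \<Sigma> f \<noteq> {} \<and> vs \<noteq> [] then Fun (binterp \<Sigma> f (map root vs)) [] else Fun f vs)"

definition sigma_model :: "('s, 'f) signature \<Rightarrow> bool" where
  "sigma_model \<Sigma> \<longleftrightarrow>
     (\<forall>s. carrier \<Sigma> s \<noteq> {}) \<and>
     (\<forall>s s'. subsort \<Sigma> s s' \<longrightarrow> carrier \<Sigma> s \<subseteq> carrier \<Sigma> s') \<and>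
     (\<forall>f ws s vs. (ws, s) \<in> ranks \<Sigma> f \<longrightarrow> list_all2 (\<lambda>v w. v \<in> carrier \<Sigma> w) vs ws
        \<longrightarrow> interp \<Sigma> f vs \<in> carrier \<Sigma> s)"

type_synonym ('s, 'f) valuation = "'s var \<Rightarrow> ('s, 'f) trm"

definition valuation :: "('s, 'f) signature \<Rightarrow> ('s, 'f) valuation \<Rightarrow> bool" where
  "valuation \<Sigma> \<alpha> \<longleftrightarrow> (\<forall>x. \<alpha> x \<in> carrier \<Sigma> (snd x))"

primrec evalt :: "('s, 'f) signature \<Rightarrow> ('s, 'f) valuation \<Rightarrow> ('s, 'f) trm \<Rightarrow> ('s, 'f) trm" where
  "evalt \<Sigma> \<alpha> (Var x) = \<alpha> x"
| "evalt \<Sigma> \<alpha> (Fun f ts) = interp \<Sigma> f (map (evalt \<Sigma> \<alpha>) ts)"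


section \<open>Constraint formulas\<close>

text \<open>Atoms are equations between arbitrary well-sorted terms, and terms of sort \<open>Bool\<close>.\<close>

datatype ('s, 'f) fm =
    Bot
  | Atom "('s, 'f) trm"
  | Eq "('s, 'f) trm" "('s, 'f) trm"
  | Neg "('s, 'f) fm"
  | And "('s, 'f) fm" "('s, 'f) fm"
  | Ex "'s var" "('s, 'f) fm"

primrec wf_fm :: "('s, 'f) signature \<Rightarrow> ('s, 'f) fm \<Rightarrow> bool" where
  "wf_fm \<Sigma> Bot \<longleftrightarrow> True"
| "wf_fm \<Sigma> (Atom t) \<longleftrightarrow> has_sort \<Sigma> t (bool_sort \<Sigma>)"
| "wf_fm \<Sigma> (Eq t u) \<longleftrightarrow> wf_trm \<Sigma> t \<and> wf_trm \<Sigma> u"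
| "wf_fm \<Sigma> (Neg \<phi>) \<longleftrightarrow> wf_fm \<Sigma> \<phi>"
| "wf_fm \<Sigma> (And \<phi> \<psi>) \<longleftrightarrow> wf_fm \<Sigma> \<phi> \<and> wf_fm \<Sigma> \<psi>"
| "wf_fm \<Sigma> (Ex x \<phi>) \<longleftrightarrow> wf_fm \<Sigma> \<phi>"

primrec fv :: "('s, 'f) fm \<Rightarrow> 's var set" where
  "fv Bot = {}"
| "fv (Atom t) = vars t"
| "fv (Eq t u) = vars t \<union> vars u"
| "fv (Neg \<phi>) = fv \<phi>"
| "fv (And \<phi> \<psi>) = fv \<phi> \<union> fv \<psi>"
| "fv (Ex x \<phi>) = fv \<phi> - {x}"

primrec sat :: "('s, 'f) signature \<Rightarrow> ('s, 'f) valuation \<Rightarrow> ('s, 'f) fm \<Rightarrow> bool" where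
  "sat \<Sigma> \<alpha> Bot \<longleftrightarrow> False"
| "sat \<Sigma> \<alpha> (Atom t) \<longleftrightarrow> evalt \<Sigma> \<alpha> t = Fun (btrue \<Sigma>) []"
| "sat \<Sigma> \<alpha> (Eq t u) \<longleftrightarrow> evalt \<Sigma> \<alpha> t = evalt \<Sigma> \<alpha> u"
| "sat \<Sigma> \<alpha> (Neg \<phi>) \<longleftrightarrow> \<not> sat \<Sigma> \<alpha> \<phi>"
| "sat \<Sigma> \<alpha> (And \<phi> \<psi>) \<longleftrightarrow> sat \<Sigma> \<alpha> \<phi> \<and> sat \<Sigma> \<alpha> \<psi>"
| "sat \<Sigma> \<alpha> (Ex x \<phi>) \<longleftrightarrow> (\<exists>v \<in> carrier \<Sigma> (snd x). sat \<Sigma> (\<alpha>(x := v)) \<phi>)"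

definition satisfiable :: "('s, 'f) signature \<Rightarrow> ('s, 'f) fm \<Rightarrow> bool" where
  "satisfiable \<Sigma> \<phi> \<longleftrightarrow> (\<exists>\<alpha>. valuation \<Sigma> \<alpha> \<and> sat \<Sigma> \<alpha> \<phi>)"

text \<open>Not capture-avoiding; only used for substitutions that replace variables by ground terms.\<close>

primrec subst_fm :: "('s var \<Rightarrow> ('s, 'f) trm) \<Rightarrow> ('s, 'f) fm \<Rightarrow> ('s, 'f) fm" where
  "subst_fm \<sigma> Bot = Bot"
| "subst_fm \<sigma> (Atom t) = Atom (subst \<sigma> t)"
| "subst_fm \<sigma> (Eq t u) = Eq (subst \<sigma> t) (subst \<sigma> u)"
| "subst_fm \<sigma> (Neg \<phi>) = Neg (subst_fm \<sigma> \<phi>)"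
| "subst_fm \<sigma> (And \<phi> \<psi>) = And (subst_fm \<sigma> \<phi>) (subst_fm \<sigma> \<psi>)"
| "subst_fm \<sigma> (Ex x \<phi>) = Ex x (subst_fm (\<sigma>(x := Var x)) \<phi>)"

text \<open>Renames bound variables as well, which is harmless since renamings are bijective.\<close>

primrec rename_fm :: "('s var \<Rightarrow> 's var) \<Rightarrow> ('s, 'f) fm \<Rightarrow> ('s, 'f) fm" where
  "rename_fm \<rho> Bot = Bot"
| "rename_fm \<rho> (Atom t) = Atom (subst (Var \<circ> \<rho>) t)"
| "rename_fm \<rho> (Eq t u) = Eq (subst (Var \<circ> \<rho>) t) (subst (Var \<circ> \<rho>) u)"
| "rename_fm \<rho> (Neg \<phi>) = Neg (rename_fm \<rho> \<phi>)"
| "rename_fm \<rho> (And \<phi> \<psi>) = And (rename_fm \<rho> \<phi>) (rename_fm \<rho> \<psi>)"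
| "rename_fm \<rho> (Ex x \<phi>) = Ex (\<rho> x) (rename_fm \<rho> \<phi>)"

definition renaming :: "('s var \<Rightarrow> 's var) \<Rightarrow> bool" where
  "renaming \<rho> \<longleftrightarrow> bij \<rho> \<and> (\<forall>x. snd (\<rho> x) = snd x)"

text \<open>Quantification over a finite set of variables, in some arbitrary order.\<close>

definition Exs :: "'s var set \<Rightarrow> ('s, 'f) fm \<Rightarrow> ('s, 'f) fm" where
  "Exs X \<phi> = foldr Ex (SOME xs. set xs = X \<and> distinct xs) \<phi>"


section \<open>Constrained terms and constrained rewriting\<close>

type_synonym ('s, 'f) cterm = "('s, 'f) trm \<times> ('s, 'f) fm"

definition vars_ct :: "('s, 'f) cterm \<Rightarrow> 's var set" where
  "vars_ct \<phi> = vars (fst \<phi>) \<union> fv (snd \<phi>)"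

definition wf_ct :: "('s, 'f) signature \<Rightarrow> ('s, 'f) cterm \<Rightarrow> bool" where
  "wf_ct \<Sigma> \<phi> \<longleftrightarrow> wf_trm \<Sigma> (fst \<phi>) \<and> wf_fm \<Sigma> (snd \<phi>)"

definition subst_ct :: "('s var \<Rightarrow> ('s, 'f) trm) \<Rightarrow> ('s, 'f) cterm \<Rightarrow> ('s, 'f) cterm" where
  "subst_ct \<sigma> \<phi> = (subst \<sigma> (fst \<phi>), subst_fm \<sigma> (snd \<phi>))"

definition ct_sem :: "('s, 'f) signature \<Rightarrow> ('s, 'f) cterm \<Rightarrow> ('s, 'f) trm set" where
  "ct_sem \<Sigma> \<phi> = {evalt \<Sigma> \<alpha> (fst \<phi>) | \<alpha>. valuation \<Sigma> \<alpha> \<and> sat \<Sigma> \<alpha> (snd \<phi>)}"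

type_synonym ('s, 'f) crule = "('s, 'f) trm \<times> ('s, 'f) trm \<times> ('s, 'f) fm"

definition lctrs :: "('s, 'f) signature \<Rightarrow> ('s, 'f) crule set \<Rightarrow> bool" where
  "lctrs \<Sigma> R \<longleftrightarrow>
     (\<forall>(l, r, \<phi>) \<in> R. (\<exists>s. has_sort \<Sigma> l s \<and> has_sort \<Sigma> r s) \<and> wf_fm \<Sigma> \<phi>)"

text \<open>\<open>c\<close> is a context in which both \<open>l\<close> and \<open>r\<close> can be placed.\<close>

definition fits :: "('s, 'f) signature \<Rightarrow> ('s, 'f) ctxt \<Rightarrow> ('s, 'f) trm \<Rightarrow> ('s, 'f) trm \<Rightarrow> bool" where
  "fits \<Sigma> c l r \<longleftrightarrow> (\<exists>h s. ctxt_sort \<Sigma> h c s \<and> has_sort \<Sigma> l h \<and> has_sort \<Sigma> r h)"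

definition rewr ::
  "('s, 'f) signature \<Rightarrow> ('s, 'f) crule set \<Rightarrow> ('s, 'f) trm \<Rightarrow> ('s, 'f) trm \<Rightarrow> bool" where
  "rewr \<Sigma> R u u' \<longleftrightarrow>
     (\<exists>l r \<phi> c \<alpha>. (l, r, \<phi>) \<in> R \<and> fits \<Sigma> c l r \<and> valuation \<Sigma> \<alpha> \<and> sat \<Sigma> \<alpha> \<phi> \<and>
        u = evalt \<Sigma> \<alpha> (plug c l) \<and> u' = evalt \<Sigma> \<alpha> (plug c r))"


section \<open>Reachability\<close>

definition post :: "('m \<Rightarrow> 'm \<Rightarrow> bool) \<Rightarrow> 'm set \<Rightarrow> 'm set" where
  "post step P = {\<gamma>'. \<exists>\<gamma>\<in>P. step \<gamma> \<gamma>'}"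

definition runnable :: "('m \<Rightarrow> 'm \<Rightarrow> bool) \<Rightarrow> 'm set \<Rightarrow> bool" where
  "runnable step P \<longleftrightarrow> P \<noteq> {} \<and> (\<forall>\<gamma>\<in>P. \<exists>\<gamma>'. step \<gamma> \<gamma>')"

coinductive reach :: "('m \<Rightarrow> 'm \<Rightarrow> bool) \<Rightarrow> 'm set \<Rightarrow> 'm set \<Rightarrow> bool" for step where
  Subsumption: "P \<subseteq> Q \<Longrightarrow> reach step P Q"
| Step: "reach step (post step (P - Q)) Q \<Longrightarrow> runnable step (P - Q) \<Longrightarrow> reach step P Q"

type_synonym ('s, 'f) rformula = "('s, 'f) cterm \<times> ('s, 'f) cterm"

definition wf_rformula :: "('s, 'f) signature \<Rightarrow> ('s, 'f) rformula \<Rightarrow> bool" where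
  "wf_rformula \<Sigma> F \<longleftrightarrow> wf_ct \<Sigma> (fst F) \<and> wf_ct \<Sigma> (snd F)"

definition model_subst ::
  "('s, 'f) signature \<Rightarrow> 's var set \<Rightarrow> ('s var \<Rightarrow> ('s, 'f) trm) \<Rightarrow> bool" where
  "model_subst \<Sigma> V \<sigma> \<longleftrightarrow> (\<forall>x\<in>V. \<sigma> x \<in> carrier \<Sigma> (snd x)) \<and> (\<forall>x. x \<notin> V \<longrightarrow> \<sigma> x = Var x)"

definition satisfies ::
  "('s, 'f) signature \<Rightarrow> ('s, 'f) crule set \<Rightarrow> ('s, 'f) rformula \<Rightarrow> bool" where
  "satisfies \<Sigma> R F \<longleftrightarrow>
     (\<forall>\<sigma>. model_subst \<Sigma> (vars_ct (fst F) \<inter> vars_ct (snd F)) \<sigma> \<longrightarrow>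
        reach (rewr \<Sigma> R) (ct_sem \<Sigma> (subst_ct \<sigma> (fst F))) (ct_sem \<Sigma> (subst_ct \<sigma> (snd F))))"

definition rf_equiv ::
  "('s, 'f) signature \<Rightarrow> ('s, 'f) rformula \<Rightarrow> ('s, 'f) rformula \<Rightarrow> bool" where
  "rf_equiv \<Sigma> F G \<longleftrightarrow> (\<forall>R. lctrs \<Sigma> R \<longrightarrow> (satisfies \<Sigma> R F \<longleftrightarrow> satisfies \<Sigma> R G))"


section \<open>Derivatives\<close>

text \<open>
  \<open>V\<close> collects the variables of the ambient reachability formula. The renamed rule avoids \<open>V\<close>,
  and so do the context variables that do not come from the constrained term itself: otherwise
  they could be captured by the right-hand side of the formula. The set is in general infinite.
\<close>

definition derivatives ::
  "('s, 'f) signature \<Rightarrow> ('s, 'f) crule set \<Rightarrow> 's var set \<Rightarrow> ('s, 'f) cterm \<Rightarrow> ('s, 'f) cterm set"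
  where
  "derivatives \<Sigma> R V \<phi> =
     {\<phi>'. \<exists>l0 r0 \<chi>0 \<rho> l r \<chi> c.
        (l0, r0, \<chi>0) \<in> R \<and> renaming \<rho> \<and>
        l = subst (Var \<circ> \<rho>) l0 \<and> r = subst (Var \<circ> \<rho>) r0 \<and> \<chi> = rename_fm \<rho> \<chi>0 \<and>
        (vars l \<union> vars r \<union> fv \<chi>) \<inter> (vars_ct \<phi> \<union> V) = {} \<and>
        fits \<Sigma> c l r \<and> (vars_ctxt c - vars_ct \<phi>) \<inter> V = {} \<and>
        \<phi>' = (plug c r, And (snd \<phi>) (And (Eq (fst \<phi>) (plug c l)) \<chi>)) \<and>
        satisfiable \<Sigma> (snd \<phi>')}"

definition derivable ::
  "('s, 'f) signature \<Rightarrow> ('s, 'f) crule set \<Rightarrow> 's var set \<Rightarrow> ('s, 'f) cterm \<Rightarrow> bool" where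
  "derivable \<Sigma> R V \<phi> \<longleftrightarrow> derivatives \<Sigma> R V \<phi> \<noteq> {}"


section \<open>The proof system\<close>

text \<open>
  In the rule \<open>der\<close> there is one premise for each of the possibly infinitely many derivatives, and
  the disjunction in its side condition is understood semantically.

  The parameters determine how the rules may be combined in an infinite proof tree: \<open>X\<close> justifies
  the premises of \<open>der\<close>, \<open>Z\<close> those of the structural rule, and the premise of \<open>subs\<close> must be
  derived by a finite number of further steps.
\<close>

inductive dstep_hat ::
  "('s, 'f) signature \<Rightarrow> ('s, 'f) crule set \<Rightarrow> ('s, 'f) rformula set \<Rightarrow> ('s, 'f) rformula set
   \<Rightarrow> ('s, 'f) rformula \<Rightarrow> bool"
  for \<Sigma> R Z X where
  ax: "dstep_hat \<Sigma> R Z X ((t, Bot), (t', \<phi>'))"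
| subs:
    "xs = vars_ct (t', \<phi>') - vars_ct (t, \<phi>) \<Longrightarrow>
     satisfiable \<Sigma> (Exs xs (And (Eq t t') \<phi>')) \<Longrightarrow>
     dstep_hat \<Sigma> R Z X ((t, And \<phi> (Neg (Exs xs (And (Eq t t') \<phi>')))), (t', \<phi>')) \<Longrightarrow>
     dstep_hat \<Sigma> R Z X ((t, \<phi>), (t', \<phi>'))"
| der:
    "V = vars_ct (t, \<phi>) \<union> vars_ct (t', \<phi>') \<Longrightarrow>
     derivable \<Sigma> R V (t, \<phi>) \<Longrightarrow>
     (\<And>\<alpha>. valuation \<Sigma> \<alpha> \<Longrightarrow> sat \<Sigma> \<alpha> \<phi> \<Longrightarrow>
        \<exists>(u, \<psi>) \<in> derivatives \<Sigma> R V (t, \<phi>).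
          sat \<Sigma> \<alpha> (Exs (vars_ct (u, \<psi>) - vars_ct (t, \<phi>)) \<psi>)) \<Longrightarrow>
     (\<And>u \<psi>. (u, \<psi>) \<in> derivatives \<Sigma> R V (t, \<phi>) \<Longrightarrow> ((u, \<psi>), (t', \<phi>')) \<in> X) \<Longrightarrow>
     dstep_hat \<Sigma> R Z X ((t, \<phi>), (t', \<phi>'))"
| struct:
    "wf_rformula \<Sigma> G \<Longrightarrow> rf_equiv \<Sigma> F G \<Longrightarrow> G \<in> Z \<Longrightarrow> dstep_hat \<Sigma> R Z X F"

text \<open>
  The formulas with a possibly infinite proof tree. Along an infinite branch, \<open>der\<close> has to occur
  infinitely often and the structural rule only finitely often. Without such a condition the
  system is unsound, because \<open>subs\<close> and the structural rule replace a formula by an equivalent one: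
  infinitely many steps from a formula to itself by reflexivity of the equivalence would prove
  every formula, and infinitely many applications of \<open>subs\<close>, whose side condition does not depend
  on \<open>\<phi>\<close>, would prove every formula with satisfiable \<open>t = t' \<and> \<phi>'\<close>. Separating structural steps by
  \<open>der\<close> does not suffice either: the equivalence does not preserve the length of a shortest path
  to a counterexample, so that \<open>der\<close> followed by a structural step can be circular.
\<close>

definition nu_dstep ::
  "('s, 'f) signature \<Rightarrow> ('s, 'f) crule set \<Rightarrow> ('s, 'f) rformula set" where
  "nu_dstep \<Sigma> R = lfp (\<lambda>Z. gfp (\<lambda>X. {F. dstep_hat \<Sigma> R Z X F}))"

end

theory Submission
  imports Defs
begin

text \<open>
  Reachability is a statewise property: a state is safe if it lies in the target or it has a
  successor and all its successors are safe. Up to renaming, a one-step rewrite of an instance of a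
  constrained term is the same thing as an instance of one of its derivatives, and derivatives do
  not change the variables shared with the right-hand side. Hence \<open>der\<close> is the unfolding of safety
  and \<open>subs\<close> removes exactly the instances that are in the target. For completeness, the satisfied
  formulas are closed under \<open>subs\<close> followed by \<open>der\<close>; the structural rule is needed only once per
  branch, to replace an unsatisfiable constraint by \<open>Bot\<close>.
\<close>

section \<open>Statewise reachability\<close>

text \<open>The union of all sets \<open>P\<close> from which \<open>Q\<close> is reachable.
  Defining it through \<open>reach\<close> makes its coinductive properties consequences of those of
  \<open>reach\<close>.\<close>

definition safe :: "('m \<Rightarrow> 'm \<Rightarrow> bool) \<Rightarrow> 'm set \<Rightarrow> 'm \<Rightarrow> bool" where
  "safe step Q \<gamma> \<longleftrightarrow> (\<exists>P. reach step P Q \<and> \<gamma> \<in> P)"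

text \<open>A set \<open>P\<close> containing a state outside \<open>Q\<close> cannot come from
  \<open>Subsumption\<close>, so \<open>Step\<close> was used; its premise is the witness of safety
  for the successors.\<close>

lemma safe_unfold:
  assumes "safe step Q \<gamma>" "\<gamma> \<notin> Q"
  shows "\<exists>\<gamma>'. step \<gamma> \<gamma>'" "step \<gamma> \<gamma>' \<Longrightarrow> safe step Q \<gamma>'"
proof -
  obtain P where P: "reach step P Q" "\<gamma> \<in> P"
    using assms(1) by (auto simp: safe_def)
  from P(1) have *: "reach step (post step (P - Q)) Q \<and> runnable step (P - Q)"
    by cases (use P(2) assms(2) in auto)
  with P(2) assms(2) show "\<exists>\<gamma>'. step \<gamma> \<gamma>'"
    by (auto simp: runnable_def)
  from * P(2) assms(2) show "safe step Q \<gamma>'" if "step \<gamma> \<gamma>'"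
    unfolding safe_def using that by (intro exI[of _ "post step (P - Q)"]) (auto simp: post_def)
qed

text \<open>The coinduction ranges over all sets of states satisfying \<open>I\<close>. If such a
  set is not included in \<open>Q\<close>, the rest is nonempty, hence runnable, and its successors
  form such a set again.\<close>

lemma reach_statewiseI:
  assumes "\<And>\<gamma>. \<gamma> \<in> P \<Longrightarrow> I \<gamma>"
    and "\<And>\<gamma>. I \<gamma> \<Longrightarrow> \<gamma> \<notin> Q \<Longrightarrow> (\<exists>\<gamma>'. step \<gamma> \<gamma>') \<and> (\<forall>\<gamma>'. step \<gamma> \<gamma>' \<longrightarrow> I \<gamma>')"
  shows "reach step P Q"
  using assms(1)
proof (coinduction arbitrary: P)
  case reach
  show ?case
  proof (cases "P \<subseteq> Q")
    case False
    then have "runnable step (P - Q)"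
      using reach assms(2) by (auto simp: runnable_def)
    moreover have "I \<gamma>" if "\<gamma> \<in> post step (P - Q)" for \<gamma>
      using that reach assms(2) by (auto simp: post_def)
    ultimately show ?thesis by auto
  qed auto
qed

lemma reach_iff_safe: "reach step P Q \<longleftrightarrow> (\<forall>\<gamma>\<in>P. safe step Q \<gamma>)"
proof
  assume "\<forall>\<gamma>\<in>P. safe step Q \<gamma>"
  then show "reach step P Q"
    by (intro reach_statewiseI[where I = "safe step Q"]) (auto intro: safe_unfold)
qed (auto simp: safe_def)

lemma safe_target: "\<gamma> \<in> Q \<Longrightarrow> safe step Q \<gamma>"
  unfolding safe_def by (auto intro: reach.Subsumption)

text \<open>Coinduction up to safety: a branch of the argument may stop at a state already known to
  be safe. In the soundness proof this happens at target states and at structural steps.\<close>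

lemma safe_coinduct:
  assumes "I \<gamma>"
    and "\<And>\<gamma>. I \<gamma> \<Longrightarrow> safe step Q \<gamma> \<or> (\<exists>\<gamma>'. step \<gamma> \<gamma>') \<and> (\<forall>\<gamma>'. step \<gamma> \<gamma>' \<longrightarrow> I \<gamma>')"
  shows "safe step Q \<gamma>"
proof -
  have "reach step {\<gamma>} Q"
    by (rule reach_statewiseI[where I = "\<lambda>\<gamma>. I \<gamma> \<or> safe step Q \<gamma>"])
      (use assms safe_unfold[of step Q] in blast)+
  then show ?thesis by (auto simp: safe_def)
qed


section \<open>Evaluation\<close>

text \<open>Variables are pairs, so these rules would split every quantifier over variables into one
  over names and one over sorts.\<close>

declare split_paired_All [simp del] split_paired_Ex [simp del]

lemma finite_vars [simp]: "finite (vars t)"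
  by (induction t) auto

lemma finite_fv [simp]: "finite (fv \<phi>)"
  by (induction \<phi>) auto

lemma finite_vars_ctxt [simp]: "finite (vars_ctxt c)"
  by (induction c) auto

lemma finite_vars_ct [simp]: "finite (vars_ct \<phi>)"
  by (simp add: vars_ct_def)

lemma evalt_cong: "(\<And>x. x \<in> vars t \<Longrightarrow> \<alpha> x = \<beta> x) \<Longrightarrow> evalt \<Sigma> \<alpha> t = evalt \<Sigma> \<beta> t"
proof (induction t)
  case (Fun f ts)
  then have "map (evalt \<Sigma> \<alpha>) ts = map (evalt \<Sigma> \<beta>) ts"
    by auto
  then show ?case by (simp del: map_eq_conv)
qed simp

lemma sat_cong: "(\<And>x. x \<in> fv \<phi> \<Longrightarrow> \<alpha> x = \<beta> x) \<Longrightarrow> sat \<Sigma> \<alpha> \<phi> \<longleftrightarrow> sat \<Sigma> \<beta> \<phi>"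
proof (induction \<phi> arbitrary: \<alpha> \<beta>)
  case (Atom t)
  have "evalt \<Sigma> \<alpha> t = evalt \<Sigma> \<beta> t"
    by (rule evalt_cong) (use Atom.prems in simp)
  then show ?case by simp
next
  case (Eq t u)
  have "evalt \<Sigma> \<alpha> t = evalt \<Sigma> \<beta> t" "evalt \<Sigma> \<alpha> u = evalt \<Sigma> \<beta> u"
    by (rule evalt_cong; use Eq.prems in simp)+
  then show ?case by simp
next
  case (Neg \<phi>)
  have "sat \<Sigma> \<alpha> \<phi> = sat \<Sigma> \<beta> \<phi>"
    by (rule Neg.IH) (use Neg.prems in simp)
  then show ?case by simp
next
  case (And \<phi> \<psi>)
  have "sat \<Sigma> \<alpha> \<phi> = sat \<Sigma> \<beta> \<phi>" "sat \<Sigma> \<alpha> \<psi> = sat \<Sigma> \<beta> \<psi>"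
    by (rule And.IH; use And.prems in simp)+
  then show ?case by simp
next
  case (Ex x \<phi>)
  have "sat \<Sigma> (\<alpha>(x := v)) \<phi> = sat \<Sigma> (\<beta>(x := v)) \<phi>" for v
    by (rule Ex.IH) (use Ex.prems in auto)
  then show ?case by simp
qed simp

lemma evalt_subst: "evalt \<Sigma> \<alpha> (subst \<sigma> t) = evalt \<Sigma> (\<lambda>x. evalt \<Sigma> \<alpha> (\<sigma> x)) t"
proof (induction t)
  case (Fun f ts)
  then have "map (evalt \<Sigma> \<alpha> \<circ> subst \<sigma>) ts = map (evalt \<Sigma> (\<lambda>x. evalt \<Sigma> \<alpha> (\<sigma> x))) ts"
    by auto
  then show ?case by (simp del: map_eq_conv)
qed simp

text \<open>Constructor ranks leave out builtin operations with arguments, so \<open>interp\<close>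
  only ever rebuilds the term. Hence elements of the model denote themselves under every
  valuation.\<close>

lemma evalt_constructor_term:
  assumes "sort_wrt le (constructor_ranks \<Sigma>) t s" "vars t = {}"
  shows "evalt \<Sigma> \<alpha> t = t"
  using assms
proof (induction rule: sort_wrt.induct)
  case (2 ws s' f ts s)
  have "map (evalt \<Sigma> \<alpha>) ts = ts"
    by (rule map_idI) (use 2 in \<open>auto simp: list_all2_conv_all_nth in_set_conv_nth all_set_conv_all_nth\<close>)
  moreover have "branks \<Sigma> f = {} \<or> ts = []"
    using 2 by (auto simp: constructor_ranks_def)
  ultimately show ?case by (auto simp: interp_def)
qed simp

lemma evalt_carrier: "v \<in> carrier \<Sigma> s \<Longrightarrow> evalt \<Sigma> \<alpha> v = v"
  by (auto simp: carrier_def interp_def evalt_constructor_term split: if_splits)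

lemma valuation_upd: "valuation \<Sigma> \<alpha> \<Longrightarrow> v \<in> carrier \<Sigma> (snd x) \<Longrightarrow> valuation \<Sigma> (\<alpha>(x := v))"
  by (simp add: valuation_def)

lemma evalt_model_subst:
  "model_subst \<Sigma> V \<sigma> \<Longrightarrow> evalt \<Sigma> \<alpha> (\<sigma> x) = (if x \<in> V then \<sigma> x else \<alpha> x)"
  by (auto simp: model_subst_def evalt_carrier)

text \<open>The values substituted are ground, so nothing is captured. Below a quantifier the bound
  variable leaves the domain of the substitution, which is why \<open>V\<close> varies in the
  induction.\<close>

lemma sat_subst_fm:
  "model_subst \<Sigma> V \<sigma> \<Longrightarrow> sat \<Sigma> \<alpha> (subst_fm \<sigma> \<phi>) \<longleftrightarrow> sat \<Sigma> (\<lambda>x. evalt \<Sigma> \<alpha> (\<sigma> x)) \<phi>"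
proof (induction \<phi> arbitrary: V \<sigma> \<alpha>)
  case (Ex x \<phi>)
  have ms: "model_subst \<Sigma> (V - {x}) (\<sigma>(x := Var x))"
    using Ex.prems by (auto simp: model_subst_def)
  have "(\<lambda>y. evalt \<Sigma> (\<alpha>(x := v)) ((\<sigma>(x := Var x)) y)) = (\<lambda>y. evalt \<Sigma> \<alpha> (\<sigma> y))(x := v)" for v
  proof
    fix y
    show "evalt \<Sigma> (\<alpha>(x := v)) ((\<sigma>(x := Var x)) y) = ((\<lambda>y. evalt \<Sigma> \<alpha> (\<sigma> y))(x := v)) y"
      by (cases "y = x") (simp_all add: evalt_model_subst[OF Ex.prems])
  qed
  then show ?case by (simp add: Ex.IH[OF ms] del: fun_upd_apply)
qed (simp_all add: evalt_subst)

text \<open>Evaluating after \<open>\<sigma>\<close> is evaluating under one valuation that follows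
  \<open>\<sigma>\<close> on \<open>V\<close>. This trades substitution instances for constrained
  valuations.\<close>

lemma mem_ct_sem_subst:
  assumes "model_subst \<Sigma> V \<sigma>"
  shows "\<gamma> \<in> ct_sem \<Sigma> (subst_ct \<sigma> p) \<longleftrightarrow>
    (\<exists>\<alpha>. valuation \<Sigma> \<alpha> \<and> (\<forall>x\<in>V. \<alpha> x = \<sigma> x) \<and> sat \<Sigma> \<alpha> (snd p) \<and> \<gamma> = evalt \<Sigma> \<alpha> (fst p))"
    (is "?L \<longleftrightarrow> ?R")
proof
  assume ?L
  then obtain \<alpha> where "valuation \<Sigma> \<alpha>" "sat \<Sigma> (\<lambda>x. evalt \<Sigma> \<alpha> (\<sigma> x)) (snd p)"
    "\<gamma> = evalt \<Sigma> (\<lambda>x. evalt \<Sigma> \<alpha> (\<sigma> x)) (fst p)"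
    by (auto simp: ct_sem_def subst_ct_def evalt_subst sat_subst_fm[OF assms])
  moreover from this have "valuation \<Sigma> (\<lambda>x. evalt \<Sigma> \<alpha> (\<sigma> x))"
    using assms by (auto simp: valuation_def evalt_model_subst[OF assms] model_subst_def)
  ultimately show ?R
    by (intro exI[of _ "\<lambda>x. evalt \<Sigma> \<alpha> (\<sigma> x)"]) (simp add: evalt_model_subst[OF assms])
next
  assume ?R
  then obtain \<alpha> where \<alpha>: "valuation \<Sigma> \<alpha>" "\<forall>x\<in>V. \<alpha> x = \<sigma> x" "sat \<Sigma> \<alpha> (snd p)"
    "\<gamma> = evalt \<Sigma> \<alpha> (fst p)"
    by blast
  then have "(\<lambda>x. evalt \<Sigma> \<alpha> (\<sigma> x)) = \<alpha>"
    by (auto simp: evalt_model_subst[OF assms])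
  with \<alpha> show ?L
    by (auto simp: ct_sem_def subst_ct_def evalt_subst sat_subst_fm[OF assms] intro!: exI[of _ \<alpha>])
qed


section \<open>Satisfaction in terms of valuations\<close>

text \<open>The meaning of the right-hand side once the shared variables \<open>S\<close> are fixed;
  their values are read off a valuation instead of being substituted.\<close>

definition targets ::
  "('s, 'f) signature \<Rightarrow> 's var set \<Rightarrow> ('s, 'f) cterm \<Rightarrow> ('s, 'f) valuation \<Rightarrow> ('s, 'f) trm set"
  where
  "targets \<Sigma> S p \<alpha> =
     {evalt \<Sigma> \<beta> (fst p) | \<beta>. valuation \<Sigma> \<beta> \<and> sat \<Sigma> \<beta> (snd p) \<and> (\<forall>x\<in>S. \<beta> x = \<alpha> x)}"

lemma targets_cong: "(\<And>x. x \<in> S \<Longrightarrow> \<alpha> x = \<beta> x) \<Longrightarrow> targets \<Sigma> S p \<alpha> = targets \<Sigma> S p \<beta>"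
  by (simp add: targets_def)

text \<open>Every instance of the left-hand side comes from a valuation, and that valuation also
  determines the substitution for the shared variables. All later arguments use this form.\<close>

lemma satisfies_iff:
  "satisfies \<Sigma> R (p, p') \<longleftrightarrow>
    (\<forall>\<alpha>. valuation \<Sigma> \<alpha> \<longrightarrow> sat \<Sigma> \<alpha> (snd p) \<longrightarrow>
      safe (rewr \<Sigma> R) (targets \<Sigma> (vars_ct p \<inter> vars_ct p') p' \<alpha>) (evalt \<Sigma> \<alpha> (fst p)))"
    (is "_ \<longleftrightarrow> (\<forall>\<alpha>. _ \<longrightarrow> _ \<longrightarrow> safe _ (targets _ ?S _ _) _)")
proof -
  have sem: "ct_sem \<Sigma> (subst_ct \<sigma> p') = targets \<Sigma> ?S p' \<alpha>"
    if "model_subst \<Sigma> ?S \<sigma>" "\<forall>x\<in>?S. \<alpha> x = \<sigma> x" for \<sigma> \<alpha>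
    using that by (auto simp: mem_ct_sem_subst[OF that(1)] targets_def)
  show ?thesis
  proof (intro iffI allI impI)
    fix \<alpha>
    assume sat: "satisfies \<Sigma> R (p, p')" and \<alpha>: "valuation \<Sigma> \<alpha>" "sat \<Sigma> \<alpha> (snd p)"
    define \<sigma> where "\<sigma> = (\<lambda>x. if x \<in> ?S then \<alpha> x else Var x)"
    have ms: "model_subst \<Sigma> ?S \<sigma>" "\<forall>x\<in>?S. \<alpha> x = \<sigma> x"
      using \<alpha>(1) by (auto simp: model_subst_def \<sigma>_def valuation_def)
    moreover have "evalt \<Sigma> \<alpha> (fst p) \<in> ct_sem \<Sigma> (subst_ct \<sigma> p)"
      using \<alpha> ms by (auto simp: mem_ct_sem_subst[OF ms(1)])
    ultimately show "safe (rewr \<Sigma> R) (targets \<Sigma> ?S p' \<alpha>) (evalt \<Sigma> \<alpha> (fst p))"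
      using sat by (auto simp: satisfies_def reach_iff_safe sem)
  next
    assume *: "\<forall>\<alpha>. valuation \<Sigma> \<alpha> \<longrightarrow> sat \<Sigma> \<alpha> (snd p) \<longrightarrow>
      safe (rewr \<Sigma> R) (targets \<Sigma> ?S p' \<alpha>) (evalt \<Sigma> \<alpha> (fst p))"
    show "satisfies \<Sigma> R (p, p')"
      unfolding satisfies_def reach_iff_safe fst_conv snd_conv
    proof (intro allI impI ballI)
      fix \<sigma> \<gamma>
      assume ms: "model_subst \<Sigma> ?S \<sigma>" and "\<gamma> \<in> ct_sem \<Sigma> (subst_ct \<sigma> p)"
      then obtain \<alpha> where "valuation \<Sigma> \<alpha>" "\<forall>x\<in>?S. \<alpha> x = \<sigma> x" "sat \<Sigma> \<alpha> (snd p)"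
        "\<gamma> = evalt \<Sigma> \<alpha> (fst p)"
        by (auto simp: mem_ct_sem_subst[OF ms])
      then show "safe (rewr \<Sigma> R) (ct_sem \<Sigma> (subst_ct \<sigma> p')) \<gamma>"
        using * sem[OF ms] by auto
    qed
  qed
qed

section \<open>Existential closure over a finite set of variables\<close>

lemma some_distinct_list:
  assumes "finite X"
  shows "set (SOME xs. set xs = X \<and> distinct xs) = X"
  using someI_ex[OF finite_distinct_list[OF assms]] by simp

lemma fv_foldr_Ex: "fv (foldr Ex xs \<phi>) = fv \<phi> - set xs"
  by (induction xs) auto

lemma fv_Exs: "finite X \<Longrightarrow> fv (Exs X \<phi>) = fv \<phi> - X"
  by (simp add: Exs_def fv_foldr_Ex some_distinct_list)

lemma wf_Exs: "wf_fm \<Sigma> (Exs X \<phi>) \<longleftrightarrow> wf_fm \<Sigma> \<phi>"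
proof -
  have "wf_fm \<Sigma> (foldr Ex xs \<phi>) \<longleftrightarrow> wf_fm \<Sigma> \<phi>" for xs
    by (induction xs) auto
  then show ?thesis by (simp add: Exs_def)
qed

lemma sat_foldr_Ex:
  assumes "valuation \<Sigma> \<alpha>"
  shows "sat \<Sigma> \<alpha> (foldr Ex xs \<phi>) \<longleftrightarrow>
    (\<exists>\<beta>. valuation \<Sigma> \<beta> \<and> (\<forall>x. x \<notin> set xs \<longrightarrow> \<beta> x = \<alpha> x) \<and> sat \<Sigma> \<beta> \<phi>)"
  using assms
proof (induction xs arbitrary: \<alpha>)
  case Nil
  then show ?case by (simp add: fun_eq_iff[symmetric])
next
  case (Cons x xs)
  show ?case
  proof
    assume "sat \<Sigma> \<alpha> (foldr Ex (x # xs) \<phi>)"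
    then obtain v where v: "v \<in> carrier \<Sigma> (snd x)" "sat \<Sigma> (\<alpha>(x := v)) (foldr Ex xs \<phi>)"
      by auto
    from v(2) obtain \<beta> where
      "valuation \<Sigma> \<beta>" "\<forall>y. y \<notin> set xs \<longrightarrow> \<beta> y = (\<alpha>(x := v)) y" "sat \<Sigma> \<beta> \<phi>"
      unfolding Cons.IH[OF valuation_upd[OF Cons.prems v(1)]] by blast
    then show "\<exists>\<beta>. valuation \<Sigma> \<beta> \<and> (\<forall>y. y \<notin> set (x # xs) \<longrightarrow> \<beta> y = \<alpha> y) \<and> sat \<Sigma> \<beta> \<phi>"
      by (intro exI[of _ \<beta>]) auto
  next
    assume "\<exists>\<beta>. valuation \<Sigma> \<beta> \<and> (\<forall>y. y \<notin> set (x # xs) \<longrightarrow> \<beta> y = \<alpha> y) \<and> sat \<Sigma> \<beta> \<phi>"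
    then obtain \<beta> where \<beta>: "valuation \<Sigma> \<beta>" "\<forall>y. y \<notin> set (x # xs) \<longrightarrow> \<beta> y = \<alpha> y" "sat \<Sigma> \<beta> \<phi>"
      by blast
    \<comment> \<open>The value of \<open>\<beta>\<close> at \<open>x\<close> witnesses the
      outermost quantifier.\<close>
    have c: "\<beta> x \<in> carrier \<Sigma> (snd x)"
      using \<beta>(1) by (simp add: valuation_def)
    have "sat \<Sigma> (\<alpha>(x := \<beta> x)) (foldr Ex xs \<phi>)"
      unfolding Cons.IH[OF valuation_upd[OF Cons.prems c]]
      using \<beta> by (intro exI[of _ \<beta>]) auto
    with c show "sat \<Sigma> \<alpha> (foldr Ex (x # xs) \<phi>)" by auto
  qed
qed

lemma sat_Exs:
  assumes "finite X" "valuation \<Sigma> \<alpha>"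
  shows "sat \<Sigma> \<alpha> (Exs X \<phi>) \<longleftrightarrow>
    (\<exists>\<beta>. valuation \<Sigma> \<beta> \<and> (\<forall>x. x \<notin> X \<longrightarrow> \<beta> x = \<alpha> x) \<and> sat \<Sigma> \<beta> \<phi>)"
  unfolding Exs_def sat_foldr_Ex[OF assms(2)] some_distinct_list[OF assms(1)] ..

text \<open>Only the variables private to \<open>p'\<close> are quantified, so the shared ones keep
  their values under \<open>\<alpha>\<close>. Thus the formula that \<open>subs\<close> negates
  holds exactly for the instances lying in the target.\<close>

lemma sat_subsumption_constraint:
  assumes "valuation \<Sigma> \<alpha>"
  shows "sat \<Sigma> \<alpha> (Exs (vars_ct p' - vars_ct p) (And (Eq (fst p) (fst p')) (snd p'))) \<longleftrightarrow>
    evalt \<Sigma> \<alpha> (fst p) \<in> targets \<Sigma> (vars_ct p \<inter> vars_ct p') p' \<alpha>"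
proof
  assume "sat \<Sigma> \<alpha> (Exs (vars_ct p' - vars_ct p) (And (Eq (fst p) (fst p')) (snd p')))"
  then obtain \<beta> where \<beta>: "valuation \<Sigma> \<beta>" "\<forall>x. x \<notin> vars_ct p' - vars_ct p \<longrightarrow> \<beta> x = \<alpha> x"
    "evalt \<Sigma> \<beta> (fst p) = evalt \<Sigma> \<beta> (fst p')" "sat \<Sigma> \<beta> (snd p')"
    using assms by (auto simp: sat_Exs)
  have "evalt \<Sigma> \<beta> (fst p) = evalt \<Sigma> \<alpha> (fst p)"
    by (rule evalt_cong) (use \<beta>(2) in \<open>auto simp: vars_ct_def\<close>)
  with \<beta> show "evalt \<Sigma> \<alpha> (fst p) \<in> targets \<Sigma> (vars_ct p \<inter> vars_ct p') p' \<alpha>"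
    unfolding targets_def by (auto intro!: exI[of _ \<beta>])
next
  assume "evalt \<Sigma> \<alpha> (fst p) \<in> targets \<Sigma> (vars_ct p \<inter> vars_ct p') p' \<alpha>"
  then obtain \<beta> where \<beta>: "valuation \<Sigma> \<beta>" "\<forall>x\<in>vars_ct p \<inter> vars_ct p'. \<beta> x = \<alpha> x"
    "evalt \<Sigma> \<alpha> (fst p) = evalt \<Sigma> \<beta> (fst p')" "sat \<Sigma> \<beta> (snd p')"
    by (auto simp: targets_def)
  \<comment> \<open>On the shared variables \<open>\<alpha>\<close> and \<open>\<beta>\<close>
    agree, so this mixture evaluates \<open>p\<close> like \<open>\<alpha>\<close> and
    \<open>p'\<close> like \<open>\<beta>\<close>.\<close>
  define \<delta> where "\<delta> = (\<lambda>x. if x \<in> vars_ct p' - vars_ct p then \<beta> x else \<alpha> x)"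
  have "valuation \<Sigma> \<delta>"
    using assms \<beta>(1) by (simp add: valuation_def \<delta>_def)
  moreover have "evalt \<Sigma> \<delta> (fst p) = evalt \<Sigma> \<alpha> (fst p)"
    by (rule evalt_cong) (auto simp: \<delta>_def vars_ct_def)
  moreover have "evalt \<Sigma> \<delta> (fst p') = evalt \<Sigma> \<beta> (fst p')"
    by (rule evalt_cong) (use \<beta>(2) in \<open>auto simp: \<delta>_def vars_ct_def\<close>)
  moreover have "sat \<Sigma> \<delta> (snd p') = sat \<Sigma> \<beta> (snd p')"
    by (rule sat_cong) (use \<beta>(2) in \<open>auto simp: \<delta>_def vars_ct_def\<close>)
  ultimately show "sat \<Sigma> \<alpha> (Exs (vars_ct p' - vars_ct p) (And (Eq (fst p) (fst p')) (snd p')))"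
    using \<beta>(3,4) by (subst sat_Exs) (auto simp: \<delta>_def assms intro!: exI[of _ \<delta>])
qed

text \<open>Strengthening the constraint by \<open>subs\<close> thus leaves the shared variables,
  and with them the targets, unchanged.\<close>

lemma vars_ct_subs:
  "vars_ct (t, And \<phi> (Neg (Exs (vars_ct (t', \<phi>') - vars_ct (t, \<phi>)) (And (Eq t t') \<phi>')))) =
    vars_ct (t, \<phi>)"
  by (auto simp: vars_ct_def fv_Exs)


section \<open>Renaming\<close>

lemma renaming_inv:
  assumes "renaming \<rho>"
  shows "renaming (inv \<rho>)"
proof -
  have "snd (inv \<rho> x) = snd (\<rho> (inv \<rho> x))" for x
    using assms by (simp add: renaming_def)
  then show ?thesis
    using assms by (simp add: renaming_def bij_imp_bij_inv bij_is_surj surj_f_inv_f)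
qed

lemma fresh_renaming:
  fixes A V :: "'s var set"
  assumes "finite A" "finite V"
  obtains \<rho> where "renaming \<rho>" "\<rho> ` A \<inter> V = {}"
proof -
  have "finite (fst ` (A \<union> V))"
    using assms by simp
  then obtain N where N: "\<And>x. x \<in> fst ` (A \<union> V) \<Longrightarrow> x < N"
    unfolding finite_nat_set_iff_bounded by blast
  \<comment> \<open>The names below \<open>N\<close> are exchanged with those from \<open>N\<close>
    to \<open>2 * N - 1\<close> and sorts are kept. This is an involution that moves every variable
    of \<open>A\<close> past all names in \<open>V\<close>.\<close>
  define \<rho> :: "'s var \<Rightarrow> 's var" where
    "\<rho> = (\<lambda>(n, s). (if n < N then n + N else if n < 2 * N then n - N else n, s))"
  have "\<rho> (\<rho> x) = x" for x
    by (auto simp: \<rho>_def split: prod.splits)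
  then have "bij \<rho>" by (rule involuntory_imp_bij)
  then have "renaming \<rho>"
    by (auto simp: renaming_def \<rho>_def split: prod.splits)
  moreover have "\<rho> x \<notin> V" if "x \<in> A" for x
  proof
    assume "\<rho> x \<in> V"
    then have "fst (\<rho> x) < N" "fst x < N"
      using N that by auto
    then show False by (cases x) (auto simp: \<rho>_def)
  qed
  ultimately show ?thesis by (intro that) auto
qed

abbreviation rename_trm :: "('s var \<Rightarrow> 's var) \<Rightarrow> ('s, 'f) trm \<Rightarrow> ('s, 'f) trm" where
  "rename_trm \<rho> \<equiv> subst (Var \<circ> \<rho>)"

text \<open>A rewrite step evaluates the rule and its context under one valuation, so both are
  renamed by the same \<open>\<rho>\<close>.\<close>

primrec rename_ctxt :: "('s var \<Rightarrow> 's var) \<Rightarrow> ('s, 'f) ctxt \<Rightarrow> ('s, 'f) ctxt" where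
  "rename_ctxt \<rho> Hole = Hole"
| "rename_ctxt \<rho> (More f ts c us) =
     More f (map (rename_trm \<rho>) ts) (rename_ctxt \<rho> c) (map (rename_trm \<rho>) us)"

lemma rename_plug: "rename_trm \<rho> (plug c t) = plug (rename_ctxt \<rho> c) (rename_trm \<rho> t)"
  by (induction c) (simp_all add: comp_def)

lemma vars_rename: "vars (rename_trm \<rho> t) = \<rho> ` vars t"
  by (induction t) auto

lemma vars_rename_ctxt: "vars_ctxt (rename_ctxt \<rho> c) = \<rho> ` vars_ctxt c"
  by (induction c) (auto simp: vars_rename)

lemma fv_rename: "bij \<rho> \<Longrightarrow> fv (rename_fm \<rho> \<phi>) = \<rho> ` fv \<phi>"
  by (induction \<phi>) (auto simp: vars_rename bij_is_inj inj_eq)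

lemma rename_rename_inv: "bij \<rho> \<Longrightarrow> rename_trm (inv \<rho>) (rename_trm \<rho> t) = t"
proof (induction t)
  case (Fun f ts)
  then show ?case by (auto intro!: map_idI)
qed (simp add: bij_is_inj)

lemma evalt_rename: "evalt \<Sigma> \<alpha> (rename_trm \<rho> t) = evalt \<Sigma> (\<alpha> \<circ> \<rho>) t"
  by (simp add: evalt_subst comp_def)

text \<open>Bound variables are renamed too: injectivity turns an update at \<open>\<rho> x\<close>
  into one at \<open>x\<close>, and preservation of sorts keeps the range of the quantifier.\<close>

lemma sat_rename: "renaming \<rho> \<Longrightarrow> sat \<Sigma> \<alpha> (rename_fm \<rho> \<phi>) \<longleftrightarrow> sat \<Sigma> (\<alpha> \<circ> \<rho>) \<phi>"
proof (induction \<phi> arbitrary: \<alpha>)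
  case (Ex x \<phi>)
  have "\<alpha>(\<rho> x := v) \<circ> \<rho> = (\<alpha> \<circ> \<rho>)(x := v)" for v
    using Ex.prems by (auto simp: renaming_def bij_is_inj inj_eq fun_eq_iff)
  then show ?case using Ex by (simp add: renaming_def del: comp_apply fun_upd_apply)
qed (simp_all add: evalt_rename)

lemma valuation_rename: "renaming \<rho> \<Longrightarrow> valuation \<Sigma> \<alpha> \<Longrightarrow> valuation \<Sigma> (\<alpha> \<circ> \<rho>)"
  unfolding valuation_def renaming_def comp_def by metis

section \<open>Well-sortedness under renaming and plugging\<close>

lemma sort_wrt_rename:
  assumes "renaming \<rho>"
  shows "sort_wrt le rk t s \<Longrightarrow> sort_wrt le rk (rename_trm \<rho> t) s"
proof (induction rule: sort_wrt.induct)
  case (2 ws s' f ts s)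
  then show ?case
    by (auto intro!: sort_wrt.intros(2) simp: list_all2_map1 elim: list_all2_mono)
qed (use assms in \<open>auto intro: sort_wrt.intros simp: renaming_def\<close>)

lemma has_sort_rename: "renaming \<rho> \<Longrightarrow> has_sort \<Sigma> t s \<Longrightarrow> has_sort \<Sigma> (rename_trm \<rho> t) s"
  by (simp add: has_sort_def sort_wrt_rename)

lemma ctxt_sort_rename:
  assumes "renaming \<rho>"
  shows "ctxt_sort \<Sigma> h c s \<Longrightarrow> ctxt_sort \<Sigma> h (rename_ctxt \<rho> c) s"
proof (induction rule: ctxt_sort.induct)
  case (2 ws w vs s' f ts c us s)
  then show ?case
    by (auto intro!: ctxt_sort.intros(2) simp: list_all2_map1
        elim!: list_all2_mono intro: has_sort_rename[OF assms] simp del: comp_apply)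
qed (auto intro: ctxt_sort.intros)

lemma fits_rename:
  "renaming \<rho> \<Longrightarrow> fits \<Sigma> c l r \<Longrightarrow> fits \<Sigma> (rename_ctxt \<rho> c) (rename_trm \<rho> l) (rename_trm \<rho> r)"
  unfolding fits_def by (elim exE conjE) (intro exI conjI ctxt_sort_rename has_sort_rename)

lemma wf_rename_fm: "renaming \<rho> \<Longrightarrow> wf_fm \<Sigma> \<phi> \<Longrightarrow> wf_fm \<Sigma> (rename_fm \<rho> \<phi>)"
  by (induction \<phi>) (simp_all add: wf_trm_def has_sort_rename, metis has_sort_rename)

lemma has_sort_subsort:
  assumes "order_sorted \<Sigma>" "has_sort \<Sigma> t s" "subsort \<Sigma> s s'"
  shows "has_sort \<Sigma> t s'"
proof -
  have trans: "subsort \<Sigma> q s'" if "subsort \<Sigma> q s" for q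
    using assms(1,3) that unfolding order_sorted_def by blast
  from assms(2) show ?thesis
    unfolding has_sort_def by cases (auto intro: sort_wrt.intros trans)
qed

lemma has_sort_plug:
  assumes "order_sorted \<Sigma>" "has_sort \<Sigma> t h"
  shows "ctxt_sort \<Sigma> h c s \<Longrightarrow> has_sort \<Sigma> (plug c t) s"
proof (induction rule: ctxt_sort.induct)
  case (2 ws w vs s' f ts c us s)
  then show ?case
    by (auto simp: has_sort_def intro!: sort_wrt.intros(2) list_all2_appendI)
qed (use assms in \<open>auto intro: has_sort_subsort\<close>)


section \<open>Derivatives and rewriting\<close>

lemma vars_plug: "vars (plug c t) = vars_ctxt c \<union> vars t"
  by (induction c) auto

text \<open>No variable is lost, because the new constraint mentions all of \<open>p\<close>. None
  is gained inside \<open>V\<close>, by the two freshness conditions. Hence a derivative has the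
  same shared variables as its origin.\<close>

lemma derivatives_shared_vars:
  assumes "(u, \<psi>) \<in> derivatives \<Sigma> R V p" "W \<subseteq> V"
  shows "vars_ct (u, \<psi>) \<inter> W = vars_ct p \<inter> W"
proof -
  from assms(1) obtain l r \<chi> c where
    fresh: "(vars l \<union> vars r \<union> fv \<chi>) \<inter> (vars_ct p \<union> V) = {}" "(vars_ctxt c - vars_ct p) \<inter> V = {}"
    and u: "u = plug c r" "\<psi> = And (snd p) (And (Eq (fst p) (plug c l)) \<chi>)"
    by (auto simp: derivatives_def)
  have "vars_ct (u, \<psi>) = vars_ct p \<union> vars_ctxt c \<union> (vars l \<union> vars r \<union> fv \<chi>)"
    by (auto simp: u vars_ct_def vars_plug)
  then show ?thesis using fresh assms(2) by blast
qed

lemma derivatives_wf: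
  assumes "order_sorted \<Sigma>" "lctrs \<Sigma> R" "wf_ct \<Sigma> p" "(u, \<psi>) \<in> derivatives \<Sigma> R V p"
  shows "wf_ct \<Sigma> (u, \<psi>)"
proof -
  from assms(4) obtain l0 r0 \<chi>0 \<rho> c where
    R: "(l0, r0, \<chi>0) \<in> R" and \<rho>: "renaming \<rho>" and
    fits: "fits \<Sigma> c (rename_trm \<rho> l0) (rename_trm \<rho> r0)" and
    u: "u = plug c (rename_trm \<rho> r0)"
    "\<psi> = And (snd p) (And (Eq (fst p) (plug c (rename_trm \<rho> l0))) (rename_fm \<rho> \<chi>0))"
    by (auto simp: derivatives_def)
  have "wf_trm \<Sigma> (plug c (rename_trm \<rho> r0))" "wf_trm \<Sigma> (plug c (rename_trm \<rho> l0))"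
    using fits has_sort_plug[OF assms(1)] unfolding fits_def wf_trm_def by blast+
  moreover have "wf_fm \<Sigma> (rename_fm \<rho> \<chi>0)"
    using R assms(2) \<rho> by (auto simp: lctrs_def intro: wf_rename_fm)
  ultimately show ?thesis using assms(3) u by (simp add: wf_ct_def)
qed

text \<open>Undoing the renaming: the original rule is used under
  \<open>\<beta> \<circ> \<rho>\<close>, and the context is renamed by \<open>inv \<rho>\<close> so
  that its variables keep their values under \<open>\<beta>\<close>.\<close>

lemma derivative_rewr:
  assumes "(u, \<psi>) \<in> derivatives \<Sigma> R V (t, \<phi>)" "valuation \<Sigma> \<beta>" "sat \<Sigma> \<beta> \<psi>"
  shows "sat \<Sigma> \<beta> \<phi>" "rewr \<Sigma> R (evalt \<Sigma> \<beta> t) (evalt \<Sigma> \<beta> u)"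
proof -
  from assms(1) obtain l0 r0 \<chi>0 \<rho> c where
    R: "(l0, r0, \<chi>0) \<in> R" and \<rho>: "renaming \<rho>" and
    fits: "fits \<Sigma> c (rename_trm \<rho> l0) (rename_trm \<rho> r0)" and
    u: "u = plug c (rename_trm \<rho> r0)"
    "\<psi> = And \<phi> (And (Eq t (plug c (rename_trm \<rho> l0))) (rename_fm \<rho> \<chi>0))"
    by (auto simp: derivatives_def)
  show "sat \<Sigma> \<beta> \<phi>" using assms(3) u by simp
  have bij: "bij \<rho>" using \<rho> by (simp add: renaming_def)
  let ?c = "rename_ctxt (inv \<rho>) c"
  have "\<beta> \<circ> \<rho> \<circ> inv \<rho> = \<beta>"
    using bij by (auto simp: fun_eq_iff bij_is_surj surj_f_inv_f)
  then have eval: "evalt \<Sigma> (\<beta> \<circ> \<rho>) (plug ?c q) = evalt \<Sigma> \<beta> (plug c (rename_trm \<rho> q))" for q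
    using rename_plug[of "inv \<rho>" c "rename_trm \<rho> q"]
      evalt_rename[of \<Sigma> "\<beta> \<circ> \<rho>" "inv \<rho>" "plug c (rename_trm \<rho> q)"]
    by (simp add: rename_rename_inv[OF bij])
  have "fits \<Sigma> ?c l0 r0"
    using fits_rename[OF renaming_inv[OF \<rho>] fits] by (simp add: rename_rename_inv[OF bij])
  moreover have "sat \<Sigma> (\<beta> \<circ> \<rho>) \<chi>0" "evalt \<Sigma> \<beta> t = evalt \<Sigma> (\<beta> \<circ> \<rho>) (plug ?c l0)"
    using assms(3) u by (simp_all add: sat_rename[OF \<rho>] eval)
  ultimately show "rewr \<Sigma> R (evalt \<Sigma> \<beta> t) (evalt \<Sigma> \<beta> u)"
    unfolding rewr_def using R valuation_rename[OF \<rho> assms(2)] u(1) eval by metis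
qed

text \<open>A rewrite step may use a context unrelated to \<open>t\<close> whose variables clash
  with \<open>V\<close>. Renaming rule and context together away from \<open>V\<close> and the
  constrained term turns the step into an instance of a derivative.\<close>

lemma rewr_derivative:
  assumes "rewr \<Sigma> R (evalt \<Sigma> \<alpha> t) \<gamma>" "valuation \<Sigma> \<alpha>" "sat \<Sigma> \<alpha> \<phi>" "finite V"
  obtains u \<psi> \<beta> where "(u, \<psi>) \<in> derivatives \<Sigma> R V (t, \<phi>)" "valuation \<Sigma> \<beta>" "sat \<Sigma> \<beta> \<psi>"
    "\<gamma> = evalt \<Sigma> \<beta> u" "\<And>x. x \<in> V \<union> vars_ct (t, \<phi>) \<Longrightarrow> \<beta> x = \<alpha> x"
proof -
  from assms(1) obtain l r \<chi> c \<delta> where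
    R: "(l, r, \<chi>) \<in> R" and fits: "fits \<Sigma> c l r" and \<delta>: "valuation \<Sigma> \<delta>" "sat \<Sigma> \<delta> \<chi>"
    "evalt \<Sigma> \<alpha> t = evalt \<Sigma> \<delta> (plug c l)" "\<gamma> = evalt \<Sigma> \<delta> (plug c r)"
    by (auto simp: rewr_def)
  let ?W = "V \<union> vars_ct (t, \<phi>)" and ?A = "vars_ctxt c \<union> vars l \<union> vars r \<union> fv \<chi>"
  obtain \<rho> where \<rho>: "renaming \<rho>" "\<rho> ` ?A \<inter> ?W = {}"
    using assms(4) by (auto intro: fresh_renaming[of ?A ?W])
  have bij: "bij \<rho>" using \<rho>(1) by (simp add: renaming_def)
  \<comment> \<open>The renamed variables lie outside \<open>?W\<close>, so one valuation can follow
    \<open>\<alpha>\<close> on the old variables and \<open>\<delta>\<close> on the renamed rule and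
    context.\<close>
  define \<beta> where "\<beta> = (\<lambda>x. if x \<in> ?W then \<alpha> x else \<delta> (inv \<rho> x))"
  have val: "valuation \<Sigma> \<beta>"
    using assms(2) valuation_rename[OF renaming_inv[OF \<rho>(1)] \<delta>(1)]
    by (simp add: valuation_def \<beta>_def)
  have \<beta>\<rho>: "(\<beta> \<circ> \<rho>) x = \<delta> x" if "x \<in> ?A" for x
    using that \<rho>(2) bij by (auto simp: \<beta>_def bij_is_inj)
  have eval: "evalt \<Sigma> \<beta> (plug (rename_ctxt \<rho> c) (rename_trm \<rho> q)) = evalt \<Sigma> \<delta> (plug c q)"
    if "vars q \<subseteq> ?A" for q
    unfolding rename_plug[symmetric] evalt_rename
    by (rule evalt_cong, rule \<beta>\<rho>) (use that in \<open>auto simp: vars_plug\<close>)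
  have t: "evalt \<Sigma> \<beta> t = evalt \<Sigma> \<alpha> t"
    by (rule evalt_cong) (auto simp: \<beta>_def vars_ct_def)
  have \<phi>: "sat \<Sigma> \<beta> \<phi> = sat \<Sigma> \<alpha> \<phi>"
    by (rule sat_cong) (auto simp: \<beta>_def vars_ct_def)
  have \<chi>: "sat \<Sigma> \<beta> (rename_fm \<rho> \<chi>) = sat \<Sigma> \<delta> \<chi>"
    unfolding sat_rename[OF \<rho>(1)] by (rule sat_cong, rule \<beta>\<rho>) auto
  let ?u = "plug (rename_ctxt \<rho> c) (rename_trm \<rho> r)"
  let ?\<psi> = "And \<phi> (And (Eq t (plug (rename_ctxt \<rho> c) (rename_trm \<rho> l))) (rename_fm \<rho> \<chi>))"
  have sat: "sat \<Sigma> \<beta> ?\<psi>"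
    using assms(3) \<delta>(2,3) eval[of l] by (simp add: t \<phi> \<chi> le_supI1)
  have "(?u, ?\<psi>) \<in> derivatives \<Sigma> R V (t, \<phi>)"
    unfolding derivatives_def mem_Collect_eq
  proof (intro exI conjI)
    show "(vars (rename_trm \<rho> l) \<union> vars (rename_trm \<rho> r) \<union> fv (rename_fm \<rho> \<chi>)) \<inter>
        (vars_ct (t, \<phi>) \<union> V) = {}"
      using \<rho>(2) by (auto simp: vars_rename fv_rename[OF bij])
    show "(vars_ctxt (rename_ctxt \<rho> c) - vars_ct (t, \<phi>)) \<inter> V = {}"
      using \<rho>(2) by (auto simp: vars_rename_ctxt)
    show "satisfiable \<Sigma> (snd (?u, ?\<psi>))"
      using sat val by (auto simp: satisfiable_def simp del: sat.simps)
  qed (use R \<rho>(1) fits_rename[OF \<rho>(1) fits] in auto)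
  then show ?thesis
  proof (rule that[OF _ val sat])
    show "\<gamma> = evalt \<Sigma> \<beta> ?u"
      unfolding \<delta>(4) by (rule eval[symmetric]) blast
    show "\<beta> x = \<alpha> x" if "x \<in> ?W" for x
      using that by (simp add: \<beta>_def)
  qed
qed


section \<open>Soundness\<close>

text \<open>Monotonicity in both parameters is what allows the inner greatest and the outer least
  fixed point to be unfolded.\<close>

lemma dstep_hat_mono:
  assumes "dstep_hat \<Sigma> R Z X F" "Z \<subseteq> Z'" "X \<subseteq> X'"
  shows "dstep_hat \<Sigma> R Z' X' F"
  using assms(1)
proof induction
  case (ax t t' \<phi>')
  show ?case by (rule dstep_hat.ax)
next
  case (subs xs t' \<phi>' t \<phi>)
  then show ?case by (blast intro: dstep_hat.subs)
next
  case (der V t \<phi> t' \<phi>')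
  show ?case
    by (rule dstep_hat.der[OF der(1,2)]) (use der(3,4) assms(3) in blast)+
next
  case (struct G F)
  then show ?case using assms(2) by (blast intro: dstep_hat.struct)
qed

text \<open>Induction over the finitely many \<open>subs\<close> steps that precede
  \<open>ax\<close>, \<open>der\<close> or \<open>struct\<close>. The target \<open>Q\<close> does
  not change on the way to the formulas in \<open>X\<close>, so soundness can coinduct against one
  fixed target.\<close>

lemma dstep_hat_safe:
  assumes "dstep_hat \<Sigma> R Z X F" "Z \<subseteq> {G. satisfies \<Sigma> R G}" "lctrs \<Sigma> R"
    and "valuation \<Sigma> \<alpha>" "sat \<Sigma> \<alpha> (snd (fst F))"
    and "Q = targets \<Sigma> (vars_ct (fst F) \<inter> vars_ct (snd F)) (snd F) \<alpha>"
    and "\<gamma> = evalt \<Sigma> \<alpha> (fst (fst F))"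
  shows "safe (rewr \<Sigma> R) Q \<gamma> \<or>
    (\<exists>\<gamma>'. rewr \<Sigma> R \<gamma> \<gamma>') \<and>
    (\<forall>\<gamma>'. rewr \<Sigma> R \<gamma> \<gamma>' \<longrightarrow>
      (\<exists>p \<beta>. (p, snd F) \<in> X \<and> valuation \<Sigma> \<beta> \<and> sat \<Sigma> \<beta> (snd p) \<and>
        Q = targets \<Sigma> (vars_ct p \<inter> vars_ct (snd F)) (snd F) \<beta> \<and> \<gamma>' = evalt \<Sigma> \<beta> (fst p)))"
  using assms
proof (induction arbitrary: \<gamma> Q rule: dstep_hat.induct)
  case (ax t t' \<phi>')
  then show ?case by simp
next
  case (subs xs t' \<phi>' t \<phi>)
  show ?case
  \<comment> \<open>An instance in the target is safe at once; any other satisfies the strengthened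
    constraint, so the induction hypothesis applies to it.\<close>
  proof (cases "\<gamma> \<in> Q")
    case True
    then show ?thesis by (simp add: safe_target)
  next
    case False
    then have "\<not> sat \<Sigma> \<alpha> (Exs xs (And (Eq t t') \<phi>'))"
      using subs.prems sat_subsumption_constraint[of \<Sigma> \<alpha> "(t', \<phi>')" "(t, \<phi>)"] subs.hyps(1)
      by simp
    then show ?thesis
      using subs.IH[of Q \<gamma>] subs.prems subs.hyps(1) by (simp add: vars_ct_subs)
  qed
next
  case (der V t \<phi> t' \<phi>')
  have sat: "sat \<Sigma> \<alpha> \<phi>" and \<gamma>: "\<gamma> = evalt \<Sigma> \<alpha> t" and \<alpha>: "valuation \<Sigma> \<alpha>"
    using der.prems by simp_all
  \<comment> \<open>The validity condition of \<open>der\<close> supplies a derivative, and hence a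
    successor of this state.\<close>
  obtain u \<psi> where d: "(u, \<psi>) \<in> derivatives \<Sigma> R V (t, \<phi>)"
    and "sat \<Sigma> \<alpha> (Exs (vars_ct (u, \<psi>) - vars_ct (t, \<phi>)) \<psi>)"
    using der.hyps(3)[OF \<alpha> sat] by auto
  then obtain \<beta> where \<beta>: "valuation \<Sigma> \<beta>" "sat \<Sigma> \<beta> \<psi>"
    "\<forall>x. x \<notin> vars_ct (u, \<psi>) - vars_ct (t, \<phi>) \<longrightarrow> \<beta> x = \<alpha> x"
    using \<alpha> by (auto simp: sat_Exs)
  have "evalt \<Sigma> \<beta> t = \<gamma>"
    unfolding \<gamma> by (rule evalt_cong) (use \<beta>(3) in \<open>auto simp: vars_ct_def\<close>)
  then have "rewr \<Sigma> R \<gamma> (evalt \<Sigma> \<beta> u)"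
    using derivative_rewr(2)[OF d \<beta>(1,2)] by simp
  \<comment> \<open>Conversely, every successor is an instance of some derivative under a valuation
    that agrees with \<open>\<alpha>\<close> on the shared variables, so its target is again
    \<open>Q\<close>.\<close>
  moreover have "\<exists>p \<beta>. (p, (t', \<phi>')) \<in> X \<and> valuation \<Sigma> \<beta> \<and> sat \<Sigma> \<beta> (snd p) \<and>
        Q = targets \<Sigma> (vars_ct p \<inter> vars_ct (t', \<phi>')) (t', \<phi>') \<beta> \<and> \<gamma>' = evalt \<Sigma> \<beta> (fst p)"
    if step: "rewr \<Sigma> R \<gamma> \<gamma>'" for \<gamma>'
  proof -
    have "finite V" using der.hyps(1) by simp
    then obtain u \<psi> \<beta> where *: "(u, \<psi>) \<in> derivatives \<Sigma> R V (t, \<phi>)" "valuation \<Sigma> \<beta>" "sat \<Sigma> \<beta> \<psi>"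
      "\<gamma>' = evalt \<Sigma> \<beta> u" "\<And>x. x \<in> V \<union> vars_ct (t, \<phi>) \<Longrightarrow> \<beta> x = \<alpha> x"
      using rewr_derivative[OF step[unfolded \<gamma>] \<alpha> sat] by metis
    have "vars_ct (u, \<psi>) \<inter> vars_ct (t', \<phi>') = vars_ct (t, \<phi>) \<inter> vars_ct (t', \<phi>')"
      using derivatives_shared_vars[OF *(1)] der.hyps(1) by simp
    moreover have "targets \<Sigma> (vars_ct (t, \<phi>) \<inter> vars_ct (t', \<phi>')) (t', \<phi>') \<beta> =
        targets \<Sigma> (vars_ct (t, \<phi>) \<inter> vars_ct (t', \<phi>')) (t', \<phi>') \<alpha>"
      by (rule targets_cong) (use *(5) in blast)
    ultimately show ?thesis
      using * der.hyps(4)[OF *(1)] der.prems(5) by (intro exI[of _ "(u, \<psi>)"] exI[of _ \<beta>]) simp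
  qed
  ultimately show ?case by auto
next
  case (struct G F)
  then have "satisfies \<Sigma> R F" by (auto simp: rf_equiv_def)
  then show ?case
    using struct.prems satisfies_iff[of \<Sigma> R "fst F" "snd F"] by simp
qed

text \<open>Since the outer fixed point is least, it suffices to treat trees whose structural
  premises are already satisfied. What remains are branches through \<open>der\<close>, and these
  are followed by coinduction on states.\<close>

lemma nu_dstep_sound:
  assumes "lctrs \<Sigma> R"
  shows "nu_dstep \<Sigma> R \<subseteq> {F. satisfies \<Sigma> R F}"
  unfolding nu_dstep_def
proof (rule lfp_lowerbound, rule subsetI, rule CollectI)
  let ?Z = "{F. satisfies \<Sigma> R F}"
  let ?Y = "gfp (\<lambda>X. {F. dstep_hat \<Sigma> R ?Z X F})"
  fix F
  assume "F \<in> ?Y"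
  have "mono (\<lambda>X. {F. dstep_hat \<Sigma> R ?Z X F})"
    by (auto intro!: monoI elim: dstep_hat_mono)
  then have Y: "dstep_hat \<Sigma> R ?Z ?Y G" if "G \<in> ?Y" for G
    using that gfp_unfold[of "\<lambda>X. {F. dstep_hat \<Sigma> R ?Z X F}"] by blast
  obtain p p' where F: "F = (p, p')" by fastforce
  show "satisfies \<Sigma> R F"
    unfolding F satisfies_iff
  proof (intro allI impI)
    fix \<alpha>
    assume \<alpha>: "valuation \<Sigma> \<alpha>" "sat \<Sigma> \<alpha> (snd p)"
    let ?Q = "targets \<Sigma> (vars_ct p \<inter> vars_ct p') p' \<alpha>"
    \<comment> \<open>The left-hand side \<open>q\<close> changes along a branch, while
      \<open>p'\<close> and the set \<open>?Q\<close> are those of the root.\<close>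
    let ?I = "\<lambda>\<gamma>. \<exists>q \<beta>. (q, p') \<in> ?Y \<and> valuation \<Sigma> \<beta> \<and> sat \<Sigma> \<beta> (snd q) \<and>
        ?Q = targets \<Sigma> (vars_ct q \<inter> vars_ct p') p' \<beta> \<and> \<gamma> = evalt \<Sigma> \<beta> (fst q)"
    show "safe (rewr \<Sigma> R) ?Q (evalt \<Sigma> \<alpha> (fst p))"
    proof (rule safe_coinduct[where I = ?I])
      show "?I (evalt \<Sigma> \<alpha> (fst p))"
        using \<open>F \<in> ?Y\<close> \<alpha> F by blast
      fix \<gamma>
      assume "?I \<gamma>"
      then obtain q \<beta> where *: "(q, p') \<in> ?Y" "valuation \<Sigma> \<beta>" "sat \<Sigma> \<beta> (snd q)"
        "?Q = targets \<Sigma> (vars_ct q \<inter> vars_ct p') p' \<beta>" "\<gamma> = evalt \<Sigma> \<beta> (fst q)"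
        by blast
      show "safe (rewr \<Sigma> R) ?Q \<gamma> \<or>
          (\<exists>\<gamma>'. rewr \<Sigma> R \<gamma> \<gamma>') \<and> (\<forall>\<gamma>'. rewr \<Sigma> R \<gamma> \<gamma>' \<longrightarrow> ?I \<gamma>')"
        using dstep_hat_safe[OF Y[OF *(1)] subset_refl assms *(2), of ?Q \<gamma>] *(3-5) by simp
    qed
  qed
qed


section \<open>Completeness\<close>

text \<open>The instance is safe but outside the target, so its safety can be unfolded by one
  step.\<close>

lemma satisfied_unsafe_instance_rewr:
  assumes "satisfies \<Sigma> R (p, p')" "valuation \<Sigma> \<alpha>" "sat \<Sigma> \<alpha> (snd p)"
    and "evalt \<Sigma> \<alpha> (fst p) \<notin> targets \<Sigma> (vars_ct p \<inter> vars_ct p') p' \<alpha>"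
  shows "\<exists>\<gamma>. rewr \<Sigma> R (evalt \<Sigma> \<alpha> (fst p)) \<gamma>"
    "rewr \<Sigma> R (evalt \<Sigma> \<alpha> (fst p)) \<gamma> \<Longrightarrow>
      safe (rewr \<Sigma> R) (targets \<Sigma> (vars_ct p \<inter> vars_ct p') p' \<alpha>) \<gamma>"
proof -
  have "safe (rewr \<Sigma> R) (targets \<Sigma> (vars_ct p \<inter> vars_ct p') p' \<alpha>) (evalt \<Sigma> \<alpha> (fst p))"
    using assms(1-3) unfolding satisfies_iff by blast
  note safe_unfold[OF this assms(4)]
  then show "\<exists>\<gamma>. rewr \<Sigma> R (evalt \<Sigma> \<alpha> (fst p)) \<gamma>"
    "rewr \<Sigma> R (evalt \<Sigma> \<alpha> (fst p)) \<gamma> \<Longrightarrow>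
      safe (rewr \<Sigma> R) (targets \<Sigma> (vars_ct p \<inter> vars_ct p') p' \<alpha>) \<gamma>"
    by blast+
qed

lemma derivative_satisfied:
  assumes "satisfies \<Sigma> R ((t, \<phi>), p')" "vars_ct p' \<subseteq> V" "(u, \<psi>) \<in> derivatives \<Sigma> R V (t, \<phi>)"
    and "\<And>\<alpha>. valuation \<Sigma> \<alpha> \<Longrightarrow> sat \<Sigma> \<alpha> \<phi> \<Longrightarrow>
      evalt \<Sigma> \<alpha> t \<notin> targets \<Sigma> (vars_ct (t, \<phi>) \<inter> vars_ct p') p' \<alpha>"
  shows "satisfies \<Sigma> R ((u, \<psi>), p')"
  unfolding satisfies_iff derivatives_shared_vars[OF assms(3,2)]
proof (intro allI impI)
  fix \<alpha>
  assume \<alpha>: "valuation \<Sigma> \<alpha>" "sat \<Sigma> \<alpha> (snd (u, \<psi>))"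
  then have "sat \<Sigma> \<alpha> \<phi>" "rewr \<Sigma> R (evalt \<Sigma> \<alpha> t) (evalt \<Sigma> \<alpha> u)"
    using derivative_rewr[OF assms(3)] by simp_all
  then show "safe (rewr \<Sigma> R) (targets \<Sigma> (vars_ct (t, \<phi>) \<inter> vars_ct p') p' \<alpha>)
      (evalt \<Sigma> \<alpha> (fst (u, \<psi>)))"
    using satisfied_unsafe_instance_rewr(2)[OF assms(1) \<alpha>(1)] assms(4)[OF \<alpha>(1)] by simp
qed

text \<open>Instances outside the target must have successors, which yields the validity condition;
  satisfiability of \<open>\<phi>\<close> then makes the term derivable. The premises are satisfied
  because instances of derivatives are successors of such instances.\<close>

lemma satisfied_der:
  assumes "order_sorted \<Sigma>" "lctrs \<Sigma> R"
    and sat: "satisfies \<Sigma> R ((t, \<phi>), (t', \<phi>'))" and wf: "wf_rformula \<Sigma> ((t, \<phi>), (t', \<phi>'))"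
    and ntgt: "\<And>\<alpha>. valuation \<Sigma> \<alpha> \<Longrightarrow> sat \<Sigma> \<alpha> \<phi> \<Longrightarrow>
      evalt \<Sigma> \<alpha> t \<notin> targets \<Sigma> (vars_ct (t, \<phi>) \<inter> vars_ct (t', \<phi>')) (t', \<phi>') \<alpha>"
    and "satisfiable \<Sigma> \<phi>"
  shows "dstep_hat \<Sigma> R Z {F. wf_rformula \<Sigma> F \<and> satisfies \<Sigma> R F} ((t, \<phi>), (t', \<phi>'))"
proof (rule dstep_hat.der[OF refl])
  let ?V = "vars_ct (t, \<phi>) \<union> vars_ct (t', \<phi>')"
  show cov: "\<exists>(u, \<psi>)\<in>derivatives \<Sigma> R ?V (t, \<phi>).
      sat \<Sigma> \<alpha> (Exs (vars_ct (u, \<psi>) - vars_ct (t, \<phi>)) \<psi>)"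
    if \<alpha>: "valuation \<Sigma> \<alpha>" "sat \<Sigma> \<alpha> \<phi>" for \<alpha>
  proof -
    obtain \<gamma> where "rewr \<Sigma> R (evalt \<Sigma> \<alpha> t) \<gamma>"
      using satisfied_unsafe_instance_rewr(1)[OF sat \<alpha>(1)] \<alpha> ntgt by auto
    then obtain u \<psi> \<beta> where d: "(u, \<psi>) \<in> derivatives \<Sigma> R ?V (t, \<phi>)" "valuation \<Sigma> \<beta>" "sat \<Sigma> \<beta> \<psi>"
      "\<And>x. x \<in> ?V \<union> vars_ct (t, \<phi>) \<Longrightarrow> \<beta> x = \<alpha> x"
      using rewr_derivative[OF _ \<alpha>, of R t \<gamma> ?V] by (metis finite_UnI finite_vars_ct)
    \<comment> \<open>\<open>\<beta>\<close> may differ from \<open>\<alpha>\<close> on variables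
      unrelated to the derivative, whereas \<open>Exs\<close> permits changes only at its new
      variables.\<close>
    define \<delta> where "\<delta> = (\<lambda>x. if x \<in> vars_ct (u, \<psi>) - vars_ct (t, \<phi>) then \<beta> x else \<alpha> x)"
    have "sat \<Sigma> \<delta> \<psi> = sat \<Sigma> \<beta> \<psi>"
      by (rule sat_cong) (use d(4) in \<open>auto simp: \<delta>_def vars_ct_def\<close>)
    moreover have "valuation \<Sigma> \<delta>"
      using \<alpha>(1) d(2) by (simp add: valuation_def \<delta>_def)
    ultimately have "sat \<Sigma> \<alpha> (Exs (vars_ct (u, \<psi>) - vars_ct (t, \<phi>)) \<psi>)"
      using d(3) by (subst sat_Exs) (auto simp: \<delta>_def \<alpha>(1) intro!: exI[of _ \<delta>])
    with d(1) show ?thesis by blast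
  qed
  show "derivable \<Sigma> R ?V (t, \<phi>)"
    using assms(6) cov by (fastforce simp: satisfiable_def derivable_def)
  show "((u, \<psi>), (t', \<phi>')) \<in> {F. wf_rformula \<Sigma> F \<and> satisfies \<Sigma> R F}"
    if d: "(u, \<psi>) \<in> derivatives \<Sigma> R ?V (t, \<phi>)" for u \<psi>
    using derivative_satisfied[OF sat _ d ntgt] derivatives_wf[OF assms(1,2) _ d] wf
    by (simp add: wf_rformula_def)
qed

text \<open>The axiom requires the constraint to be literally \<open>Bot\<close>. Formulas with no
  left-hand instances hold in every system, so they are all equivalent.\<close>

lemma dstep_hat_unsatisfiable:
  assumes "wf_rformula \<Sigma> ((t, \<phi>), p')" "\<not> satisfiable \<Sigma> \<phi>" "((t, Bot), p') \<in> Z"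
  shows "dstep_hat \<Sigma> R Z X ((t, \<phi>), p')"
proof (rule dstep_hat.struct)
  show "wf_rformula \<Sigma> ((t, Bot), p')"
    using assms(1) by (simp add: wf_rformula_def wf_ct_def)
  have "satisfies \<Sigma> R' ((t, \<phi>), p')" "satisfies \<Sigma> R' ((t, Bot), p')" for R'
    using assms(2) unfolding satisfies_iff satisfiable_def by simp_all
  then show "rf_equiv \<Sigma> ((t, \<phi>), p') ((t, Bot), p')"
    by (simp add: rf_equiv_def)
qed (rule assms(3))

lemma nu_dstep_unfold: "nu_dstep \<Sigma> R = gfp (\<lambda>X. {F. dstep_hat \<Sigma> R (nu_dstep \<Sigma> R) X F})"
proof -
  have "mono (\<lambda>Z. gfp (\<lambda>X. {F. dstep_hat \<Sigma> R Z X F}))"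
    by (intro monoI gfp_mono) (auto elim: dstep_hat_mono)
  then show ?thesis unfolding nu_dstep_def by (rule lfp_unfold)
qed

text \<open>Premises of \<open>der\<close> may return to \<open>W\<close>, while structural premises
  must already belong to the least fixed point.\<close>

lemma nu_dstep_coinduct:
  assumes "F \<in> W" "\<And>G. G \<in> W \<Longrightarrow> dstep_hat \<Sigma> R (nu_dstep \<Sigma> R) W G"
  shows "F \<in> nu_dstep \<Sigma> R"
  by (subst nu_dstep_unfold, rule weak_coinduct[OF assms(1)]) (use assms(2) in blast)

lemma Bot_in_nu_dstep: "((t, Bot), (t', \<phi>')) \<in> nu_dstep \<Sigma> R"
  by (rule nu_dstep_coinduct[of _ "{((t, Bot), (t', \<phi>'))}"]) (auto intro: dstep_hat.ax)

lemma satisfied_dstep_hat: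
  assumes "order_sorted \<Sigma>" "lctrs \<Sigma> R"
    and sat: "satisfies \<Sigma> R ((t, \<phi>), (t', \<phi>'))" and wf: "wf_rformula \<Sigma> ((t, \<phi>), (t', \<phi>'))"
  shows "dstep_hat \<Sigma> R (nu_dstep \<Sigma> R) {F. wf_rformula \<Sigma> F \<and> satisfies \<Sigma> R F} ((t, \<phi>), (t', \<phi>'))"
proof -
  let ?W = "{F. wf_rformula \<Sigma> F \<and> satisfies \<Sigma> R F}"
  let ?S = "vars_ct (t, \<phi>) \<inter> vars_ct (t', \<phi>')"
  define sub where "sub = Exs (vars_ct (t', \<phi>') - vars_ct (t, \<phi>)) (And (Eq t t') \<phi>')"
  let ?\<phi> = "And \<phi> (Neg sub)"
  have sat_sub: "sat \<Sigma> \<alpha> sub \<longleftrightarrow> evalt \<Sigma> \<alpha> t \<in> targets \<Sigma> ?S (t', \<phi>') \<alpha>"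
    if "valuation \<Sigma> \<alpha>" for \<alpha>
    using sat_subsumption_constraint[OF that, of "(t', \<phi>')" "(t, \<phi>)"] by (simp add: sub_def)
  \<comment> \<open>Used with \<open>\<psi>\<close> equal to \<open>?\<phi>\<close> after
    \<open>subs\<close>, or to \<open>\<phi>\<close> itself when \<open>subs\<close> is not
    applicable.\<close>
  have main: "dstep_hat \<Sigma> R (nu_dstep \<Sigma> R) ?W ((t, \<psi>), (t', \<phi>'))"
    if "satisfies \<Sigma> R ((t, \<psi>), (t', \<phi>'))" "wf_rformula \<Sigma> ((t, \<psi>), (t', \<phi>'))"
      "vars_ct (t, \<psi>) = vars_ct (t, \<phi>)"
      "\<And>\<alpha>. valuation \<Sigma> \<alpha> \<Longrightarrow> sat \<Sigma> \<alpha> \<psi> \<Longrightarrow> \<not> sat \<Sigma> \<alpha> sub" for \<psi>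
  proof (cases "satisfiable \<Sigma> \<psi>")
    case True
    show ?thesis
      by (rule satisfied_der[OF assms(1,2) that(1,2) _ True]) (use that(3,4) sat_sub in auto)
  next
    case False
    then show ?thesis using that(2) by (intro dstep_hat_unsatisfiable Bot_in_nu_dstep)
  qed
  have vars: "vars_ct (t, ?\<phi>) = vars_ct (t, \<phi>)"
    by (simp add: sub_def vars_ct_subs)
  show ?thesis
  proof (cases "satisfiable \<Sigma> sub")
    case True
    have "dstep_hat \<Sigma> R (nu_dstep \<Sigma> R) ?W ((t, ?\<phi>), (t', \<phi>'))"
    proof (rule main)
      show "satisfies \<Sigma> R ((t, ?\<phi>), (t', \<phi>'))"
        using sat by (simp add: satisfies_iff vars)
      show "wf_rformula \<Sigma> ((t, ?\<phi>), (t', \<phi>'))"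
        using wf by (simp add: wf_rformula_def wf_ct_def sub_def wf_Exs)
    qed (simp_all add: vars)
    with True show ?thesis
      unfolding sub_def by (rule dstep_hat.subs[OF refl])
  next
    case False
    \<comment> \<open>The side condition of \<open>subs\<close> fails here, but then no instance is
      in the target and nothing has to be removed.\<close>
    then show ?thesis using sat wf by (intro main) (auto simp: satisfiable_def)
  qed
qed

theorem theorem2:
  fixes \<Sigma> :: "('s, 'f) signature"
    and R :: "('s, 'f) crule set"
    and \<phi> \<phi>' :: "('s, 'f) cterm"
  assumes "signature_mod_builtins \<Sigma>"
    and "sigma_model \<Sigma>"
    and "lctrs \<Sigma> R"
    and "wf_rformula \<Sigma> (\<phi>, \<phi>')"
  shows "satisfies \<Sigma> R (\<phi>, \<phi>') \<longleftrightarrow> (\<phi>, \<phi>') \<in> nu_dstep \<Sigma> R"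
proof
  assume "(\<phi>, \<phi>') \<in> nu_dstep \<Sigma> R"
  then show "satisfies \<Sigma> R (\<phi>, \<phi>')"
    using nu_dstep_sound[OF assms(3)] by blast
next
  let ?W = "{F. wf_rformula \<Sigma> F \<and> satisfies \<Sigma> R F}"
  have os: "order_sorted \<Sigma>"
    using assms(1) by (simp add: signature_mod_builtins_def)
  assume "satisfies \<Sigma> R (\<phi>, \<phi>')"
  with assms(4) have "(\<phi>, \<phi>') \<in> ?W"
    by simp
  then show "(\<phi>, \<phi>') \<in> nu_dstep \<Sigma> R"
  proof (rule nu_dstep_coinduct)
    fix G
    assume "G \<in> ?W"
    moreover obtain t \<psi> t' \<psi>' where "G = ((t, \<psi>), (t', \<psi>'))"
      by (metis surj_pair)
    ultimately show "dstep_hat \<Sigma> R (nu_dstep \<Sigma> R) ?W G"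
      using satisfied_dstep_hat[OF os assms(3)] by simp
  qed
qed

end
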